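(* Let $G$ be a countable locally nilpotent group (every finitely generated subgroup of $G$ is nilpotent) acting in a Borel fashion on a standard Borel space $X$. Then the induced orbit equivalence relation $E^X_G=\{(x,y)\in X\times X : \exists g\in G,\ g\cdot x=y\}$ is hyperfinite.
   Context: A Borel equivalence relation $E$ on a standard Borel space is hyperfinite if it is the union of an increasing sequence of finite Borel equivalence relations (equivalence relations all of whose classes are finite). *)

theory Defs
  imports "HOL-Analysis.Analysis" "HOL-Probability.Probability" "HOL-Algebra.Algebra"
begin

definition commutator_set :: "('a, 'b) monoid_scheme \<Rightarrow> 'a set \<Rightarrow> 'a set \<Rightarrow> 'a set" where
  "commutator_set H A B =
     {a \<otimes>\<^bsub>H\<^esub> b \<otimes>\<^bsub>H\<^esub> inv\<^bsub>H\<^esub> a \<otimes>\<^bsub>H\<^esub> inv\<^bsub>H\<^esub> b | a b. a \<in> A \<and> b \<in> B}"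

fun lower_central :: "('a, 'b) monoid_scheme \<Rightarrow> nat \<Rightarrow> 'a set" where
  "lower_central H 0 = carrier H"
| "lower_central H (Suc n) = generate H (commutator_set H (lower_central H n) (carrier H))"

definition nilpotent_group :: "('a, 'b) monoid_scheme \<Rightarrow> bool" where
  "nilpotent_group H \<longleftrightarrow> group H \<and> (\<exists>n. lower_central H n = {\<one>\<^bsub>H\<^esub>})"

definition locally_nilpotent :: "('a, 'b) monoid_scheme \<Rightarrow> bool" where
  "locally_nilpotent G \<longleftrightarrow>
     (\<forall>S. S \<subseteq> carrier G \<and> finite S \<longrightarrow> nilpotent_group (subgroup_generated G S))"

definition Polish_topology :: "'a topology \<Rightarrow> bool" where
  "Polish_topology T \<longleftrightarrow> completely_metrizable_space T \<and> separable_space T"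

definition standard_borel_space :: "'a measure \<Rightarrow> bool" where
  "standard_borel_space M \<longleftrightarrow>
     (\<exists>T. Polish_topology T \<and> topspace T = space M \<and>
          sets M = sigma_sets (topspace T) {U. openin T U})"

definition finite_borel_equivalence :: "'a measure \<Rightarrow> ('a \<times> 'a) set \<Rightarrow> bool" where
  "finite_borel_equivalence M F \<longleftrightarrow>
     F \<in> sets (M \<Otimes>\<^sub>M M) \<and> equiv (space M) F \<and> (\<forall>x \<in> space M. finite (F `` {x}))"

definition hyperfinite :: "'a measure \<Rightarrow> ('a \<times> 'a) set \<Rightarrow> bool" where
  "hyperfinite M E \<longleftrightarrow>
     (\<exists>F :: nat \<Rightarrow> ('a \<times> 'a) set.
        (\<forall>n. finite_borel_equivalence M (F n)) \<and> incseq F \<and> (\<Union>n. F n) = E)"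

definition orbit_equivalence :: "('g, 'b) monoid_scheme \<Rightarrow> 'x measure \<Rightarrow> ('g \<Rightarrow> 'x \<Rightarrow> 'x) \<Rightarrow> ('x \<times> 'x) set" where
  "orbit_equivalence G M \<phi> =
     {(x, y) \<in> space M \<times> space M. \<exists>g \<in> carrier G. \<phi> g x = y}"

end

theory Submission
  imports Defs
begin

text \<open>
  The group is the union of finitely generated nilpotent subgroups \<open>H n\<close>. Each \<open>H n\<close> has polynomial
  growth, so at arbitrarily large scales \<open>X\<close> is covered by a fixed number \<open>D n\<close> of families of
  far apart \<open>H n\<close>-bounded Borel pieces.

  Given \<open>D n\<close> bounded relations \<open>P i\<close>, cut \<open>X\<close> repeatedly, at growing scales, along
  \<open>P i\<close>-saturated pieces of type \<open>i\<close>; after each cut everything near the boundaries of type \<open>i\<close>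
  is glued for all later cuts of type \<open>i\<close>. A fixed pair is then separated at most once by each type,
  and never by a type \<open>i\<close> with the pair in \<open>P i\<close>. So the new sequence of relations cuts the pair at
  most as often as the \<open>P i\<close> do, however large \<open>D n\<close> is.

  Iterating over \<open>n\<close> while leaving one relation of each level unused as a \<open>P i\<close>, the number of
  cuts of a fixed pair drops whenever the unused relation cuts it. Hence the unused relations
  eventually contain every pair of orbit equivalent points.
\<close>

section \<open>Word growth in nilpotent groups\<close>

text \<open>Products of exactly n letters. For V containing \<one> these sets increase with n and
  are the balls of the word length.\<close>

fun set_power :: "('a, 'b) monoid_scheme \<Rightarrow> 'a set \<Rightarrow> nat \<Rightarrow> 'a set" where
  "set_power G V 0 = {\<one>\<^bsub>G\<^esub>}"
| "set_power G V (Suc n) = V <#>\<^bsub>G\<^esub> set_power G V n"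

definition poly_growth :: "('a, 'b) monoid_scheme \<Rightarrow> 'a set \<Rightarrow> bool" where
  "poly_growth G T \<longleftrightarrow> (\<exists>C d. \<forall>n. card (set_power G T n) \<le> C * (n + 1) ^ d)"

text \<open>The subgroup shares multiplication and unit with \<open>G\<close>, so growth proved
  inside a nilpotent subgroup is growth in \<open>G\<close>.\<close>

lemma set_power_subgroup_generated [simp]:
  "set_power (subgroup_generated G S) V n = set_power G V n"
  by (induction n) (auto simp: set_mult_def)

context group
begin

lemma set_power_subset_subgroup:
  assumes "subgroup H G" "V \<subseteq> H"
  shows "set_power G V n \<subseteq> H"
proof (induction n)
  case 0
  then show ?case using assms subgroup.one_closed by auto
next
  case (Suc n)
  then show ?case using assms subgroup.m_closed[OF assms(1)]
    by (auto simp: set_mult_def subset_iff)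
qed

lemma set_power_closed: "V \<subseteq> carrier G \<Longrightarrow> set_power G V n \<subseteq> carrier G"
  using set_power_subset_subgroup[OF subgroup_self] .

lemma finite_set_power: "finite V \<Longrightarrow> finite (set_power G V n)"
  by (induction n) (auto simp: set_mult_def)

lemma set_power_one_gen: "V \<subseteq> carrier G \<Longrightarrow> set_power G V (Suc 0) = V"
  by (auto simp: set_mult_def subset_iff)

lemma set_power_add:
  assumes V: "V \<subseteq> carrier G" and a: "a \<in> set_power G V m" and b: "b \<in> set_power G V n"
  shows "a \<otimes> b \<in> set_power G V (m + n)"
  using a
proof (induction m arbitrary: a)
  case 0
  moreover have "b \<in> carrier G" using b set_power_closed[OF V] by blast
  ultimately show ?case using b by simp
next
  case (Suc m)
  then obtain v w where vw: "v \<in> V" "w \<in> set_power G V m" "a = v \<otimes> w"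
    by (auto simp: set_mult_def)
  have "a \<otimes> b = v \<otimes> (w \<otimes> b)"
    using vw V b set_power_closed[OF V] by (metis m_assoc subsetD)
  then show ?case using Suc.IH[OF vw(2)] vw(1) by (auto simp: set_mult_def)
qed

lemma one_in_set_power: "\<one> \<in> V \<Longrightarrow> \<one> \<in> set_power G V n"
  by (induction n) (auto simp: set_mult_def intro!: bexI[of _ \<one>])

lemma set_power_mono:
  assumes "V \<subseteq> carrier G" "\<one> \<in> V" "m \<le> n"
  shows "set_power G V m \<subseteq> set_power G V n"
proof
  fix x assume x: "x \<in> set_power G V m"
  have "x \<otimes> \<one> \<in> set_power G V (m + (n - m))"
    by (rule set_power_add[OF assms(1) x one_in_set_power[OF assms(2)]])
  then show "x \<in> set_power G V n"
    using x set_power_closed[OF assms(1)] assms(3) by (auto simp: subset_iff)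
qed

lemma set_power_mono_base: "V \<subseteq> W \<Longrightarrow> set_power G V n \<subseteq> set_power G W n"
  by (induction n) (auto simp: set_mult_def)

lemma set_power_inv:
  assumes V: "V \<subseteq> carrier G" and sym: "\<And>v. v \<in> V \<Longrightarrow> inv v \<in> V" and a: "a \<in> set_power G V n"
  shows "inv a \<in> set_power G V n"
  using a
proof (induction n arbitrary: a)
  case 0
  then show ?case by auto
next
  case (Suc n)
  then obtain v w where vw: "v \<in> V" "w \<in> set_power G V n" "a = v \<otimes> w"
    by (auto simp: set_mult_def)
  have "inv a = inv w \<otimes> inv v"
    using vw V set_power_closed[OF V] by (auto simp: inv_mult_group subset_iff)
  moreover have "inv v \<in> set_power G V (Suc 0)"
    using sym[OF vw(1)] set_power_one_gen[OF V] by simp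
  ultimately show ?case
    using set_power_add[OF V Suc.IH[OF vw(2)], of "inv v" "Suc 0"] by simp
qed

lemma set_power_set_power:
  assumes V: "V \<subseteq> carrier G"
  shows "set_power G (set_power G V m) n \<subseteq> set_power G V (m * n)"
proof (induction n)
  case (Suc n)
  then show ?case
    using set_power_add[OF V, of _ m _ "m * n"] by (fastforce simp: set_mult_def)
qed auto

lemma set_power_generate:
  assumes V: "V \<subseteq> carrier G" and one: "\<one> \<in> V" and sym: "\<And>v. v \<in> V \<Longrightarrow> inv v \<in> V"
    and x: "x \<in> generate G V"
  shows "\<exists>n. x \<in> set_power G V n"
  using x
proof (induction rule: generate.induct)
  case (eng h1 h2)
  then show ?case using set_power_add[OF V] by blast
next
  case one then show ?case by (intro exI[of _ 0]) simp
qed (use sym set_power_one_gen[OF V] in blast)+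

section \<open>Polynomial growth over a filtration\<close>

text \<open>With y = x^-1 t^-1 x t, the conjugate of x by t^(a+1) is the product of the conjugates
  of x and of y by t^a, and y lies one step deeper in the filtration \<Gamma>. So the induction is
  on the number j of steps left until \<Gamma> is trivial, and then on a.\<close>

lemma conj_pow_in_set_power:
  assumes T: "T \<subseteq> carrier G" "\<one> \<in> T" and t: "t \<in> carrier G" and c: "\<Gamma> c = {\<one>}"
    and comm: "\<And>x i. x \<in> T \<Longrightarrow> x \<in> \<Gamma> i \<Longrightarrow>
      inv x \<otimes> inv t \<otimes> x \<otimes> t \<in> T \<and> inv x \<otimes> inv t \<otimes> x \<otimes> t \<in> \<Gamma> (Suc i)"
    and x: "x \<in> T" "x \<in> \<Gamma> i" "i + j = c"
  shows "inv (t [^] a) \<otimes> x \<otimes> t [^] a \<in> set_power G T ((a + 1) ^ j)"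
  using x
proof (induction j arbitrary: x i a)
  case 0
  then have "x = \<one>" using c by auto
  then show ?case using T t set_power_one_gen[OF T(1)] by auto
next
  case (Suc j)
  note prems = Suc.prems and IH = Suc.IH
  show ?case
  proof (induction a)
    case 0
    then show ?case using prems T t set_power_one_gen[OF T(1)] by (auto simp: subset_iff)
  next
    case (Suc a)
    define y where "y = inv x \<otimes> inv t \<otimes> x \<otimes> t"
    have xy: "x \<in> carrier G" "y \<in> carrier G" "y \<in> T" "y \<in> \<Gamma> (Suc i)"
      using comm[OF prems(1,2)] T prems unfolding y_def by auto
    have "inv t \<otimes> x \<otimes> t = x \<otimes> y"
      using xy t unfolding y_def by (simp add: m_assoc[symmetric])
    moreover have "inv (t [^] Suc a) \<otimes> x \<otimes> t [^] Suc a
        = inv (t [^] a) \<otimes> (inv t \<otimes> x \<otimes> t) \<otimes> t [^] a"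
      unfolding nat_pow_Suc2[OF t] using xy t by (simp add: inv_mult_group m_assoc)
    moreover have "\<dots> = (inv (t [^] a) \<otimes> x \<otimes> t [^] a) \<otimes> (inv (t [^] a) \<otimes> y \<otimes> t [^] a)"
      if "inv t \<otimes> x \<otimes> t = x \<otimes> y"
    proof -
      have "t [^] a \<otimes> (inv (t [^] a) \<otimes> (y \<otimes> t [^] a)) = y \<otimes> t [^] a"
        using xy t by (simp add: m_assoc[symmetric])
      then show ?thesis unfolding that using xy t by (simp add: m_assoc)
    qed
    ultimately have eq: "inv (t [^] Suc a) \<otimes> x \<otimes> t [^] Suc a
        = (inv (t [^] a) \<otimes> x \<otimes> t [^] a) \<otimes> (inv (t [^] a) \<otimes> y \<otimes> t [^] a)" by simp
    have "inv (t [^] a) \<otimes> y \<otimes> t [^] a \<in> set_power G T ((a + 1) ^ j)"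
      using prems xy by (intro IH[of y "Suc i"]) auto
    from set_power_add[OF T(1) Suc.IH this]
    have "inv (t [^] Suc a) \<otimes> x \<otimes> t [^] Suc a \<in> set_power G T ((a + 1) ^ Suc j + (a + 1) ^ j)"
      unfolding eq .
    moreover have "(a + 1) ^ Suc j + (a + 1) ^ j \<le> (Suc a + 1) ^ Suc j"
    proof -
      have "(a + 1) ^ Suc j + (a + 1) ^ j = (a + 2) * (a + 1) ^ j" by simp
      also have "\<dots> \<le> (a + 2) * (a + 2) ^ j" by (intro mult_left_mono power_mono) auto
      finally show ?thesis by simp
    qed
    ultimately show ?case using set_power_mono[OF T] by blast
  qed
qed

text \<open>All letters t are collected on the left: y t^a v = t^a (t^-a y t^a) v, and by
  \<open>conj\<close> the conjugate is a word over T of length (a + 1)^c. So a word of length n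
  becomes t^a v with a \<le> n and v of polynomial length, and the pairs of a and v are
  counted.\<close>

lemma poly_growth_insert:
  assumes T: "finite T" "T \<subseteq> carrier G" "\<one> \<in> T" and pg: "poly_growth G T" and t: "t \<in> carrier G"
    and conj: "\<And>x a. x \<in> T \<Longrightarrow> inv (t [^] a) \<otimes> x \<otimes> t [^] a \<in> set_power G T ((a + 1) ^ c)"
  shows "poly_growth G (insert t T)"
proof -
  obtain C d where Cd: "\<And>n. card (set_power G T n) \<le> C * (n + 1) ^ d"
    using pg unfolding poly_growth_def by auto
  have normal_form: "\<exists>a\<le>n. \<exists>v\<in>set_power G T (n * (n + 1) ^ c). w = t [^] a \<otimes> v"
    if "w \<in> set_power G (insert t T) n" for w n
    using that
  proof (induction n arbitrary: w)
    case 0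
    then show ?case by auto
  next
    case (Suc n)
    then obtain y w' where y: "y \<in> insert t T" "w' \<in> set_power G (insert t T) n" "w = y \<otimes> w'"
      by (auto simp: set_mult_def)
    from Suc.IH[OF y(2)] obtain a v where av: "a \<le> n" "v \<in> set_power G T (n * (n + 1) ^ c)"
      "w' = t [^] a \<otimes> v" by auto
    have vG: "v \<in> carrier G" using av set_power_closed[OF T(2)] by auto
    have le: "(n + 1) ^ c + n * (n + 1) ^ c \<le> Suc n * (Suc n + 1) ^ c"
    proof -
      have "(n + 1) ^ c + n * (n + 1) ^ c = Suc n * (n + 1) ^ c" by simp
      also have "\<dots> \<le> Suc n * (Suc n + 1) ^ c" by (intro mult_left_mono power_mono) auto
      finally show ?thesis .
    qed
    show ?case
    proof (cases "y = t")
      case True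
      have "w = t [^] Suc a \<otimes> v"
        unfolding nat_pow_Suc2[OF t] using True y av t vG by (simp add: m_assoc)
      moreover have "v \<in> set_power G T (Suc n * (Suc n + 1) ^ c)"
        using av(2) le set_power_mono[OF T(2,3)] by (meson le_add2 order_trans subsetD)
      ultimately show ?thesis using av(1) by (intro exI[of _ "Suc a"]) auto
    next
      case False
      then have yT: "y \<in> T" using y by auto
      then have yG: "y \<in> carrier G" using T by auto
      define u where "u = inv (t [^] a) \<otimes> y \<otimes> t [^] a"
      have "u \<in> set_power G T ((a + 1) ^ c)" unfolding u_def by (rule conj[OF yT])
      then have u: "u \<in> set_power G T ((n + 1) ^ c)"
        using set_power_mono[OF T(2,3), of "(a + 1) ^ c" "(n + 1) ^ c"] av(1)
        by (auto simp: power_mono)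
      have "u \<otimes> v \<in> set_power G T (Suc n * (Suc n + 1) ^ c)"
        using set_power_add[OF T(2) u av(2)] le set_power_mono[OF T(2,3)] by blast
      moreover have "w = t [^] a \<otimes> (u \<otimes> v)"
      proof -
        have uG: "u \<in> carrier G" unfolding u_def using yG t by auto
        have "t [^] a \<otimes> u = y \<otimes> t [^] a"
          unfolding u_def using yG t by (simp add: m_assoc[symmetric])
        then have "t [^] a \<otimes> (u \<otimes> v) = y \<otimes> t [^] a \<otimes> v"
          using uG vG t by (metis m_assoc nat_pow_closed)
        then show ?thesis using y av yG vG t by (simp add: m_assoc)
      qed
      ultimately show ?thesis using av(1) by (intro exI[of _ a]) auto
    qed
  qed
  have "card (set_power G (insert t T) n) \<le> C * (n + 1) ^ ((c + 1) * d + 1)" for n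
  proof -
    let ?N = "n * (n + 1) ^ c"
    have "set_power G (insert t T) n \<subseteq> (\<lambda>(a, v). t [^] a \<otimes> v) ` ({..n} \<times> set_power G T ?N)"
      using normal_form by fastforce
    then have "card (set_power G (insert t T) n) \<le> card ({..n} \<times> set_power G T ?N)"
      using finite_set_power[OF T(1)] by (meson finite_SigmaI finite_atMost surj_card_le)
    also have "\<dots> = (n + 1) * card (set_power G T ?N)" by (simp add: card_cartesian_product)
    also have "\<dots> \<le> (n + 1) * (C * (?N + 1) ^ d)" using Cd by (intro mult_left_mono) auto
    \<comment> \<open>Here n (n + 1)^c + 1 \<le> (n + 1)^(c + 1).\<close>
    also have "\<dots> \<le> (n + 1) * (C * ((n + 1) ^ (c + 1)) ^ d)"
      by (intro mult_left_mono power_mono) (auto simp: algebra_simps)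
    also have "\<dots> = C * (n + 1) ^ ((c + 1) * d + 1)"
      unfolding power_add[of "n + 1" "(c + 1) * d" 1] power_mult[of "n + 1" "c + 1" d] power_one_right
      by (simp only: ac_simps)
    finally show ?thesis .
  qed
  then show ?thesis unfolding poly_growth_def by blast
qed

text \<open>The letters of \<open>L\<close> are adjoined one at a time, those deep in the filtration first;
  conjugation by the new letter then lengthens words over the old ones only polynomially.\<close>

lemma poly_growth_commutator_closed:
  assumes L: "finite L" "L \<subseteq> carrier G" "\<one> \<in> L" "L \<subseteq> \<Gamma> 0"
    and closed: "\<And>x y. x \<in> L \<Longrightarrow> y \<in> L \<Longrightarrow> inv x \<otimes> inv y \<otimes> x \<otimes> y \<in> L"
    and c: "\<Gamma> c = {\<one>}" and dec: "\<And>i. \<Gamma> (Suc i) \<subseteq> \<Gamma> i"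
    and one: "\<And>i. \<one> \<in> \<Gamma> i"
    and left: "\<And>x y i. x \<in> L \<Longrightarrow> y \<in> L \<Longrightarrow> x \<in> \<Gamma> i \<Longrightarrow> inv x \<otimes> inv y \<otimes> x \<otimes> y \<in> \<Gamma> (Suc i)"
    and right: "\<And>x y i. x \<in> L \<Longrightarrow> y \<in> L \<Longrightarrow> y \<in> \<Gamma> i \<Longrightarrow> inv x \<otimes> inv y \<otimes> x \<otimes> y \<in> \<Gamma> (Suc i)"
  shows "poly_growth G L"
proof -
  have step: "poly_growth G ((L \<inter> \<Gamma> (Suc i)) \<union> F)"
    if "poly_growth G (L \<inter> \<Gamma> (Suc i))" "finite F" "F \<subseteq> L \<inter> \<Gamma> i" for i F
    using that(2,3)
  proof (induction F rule: finite_induct)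
    case empty
    then show ?case using that(1) by simp
  next
    case (insert t F)
    let ?T = "(L \<inter> \<Gamma> (Suc i)) \<union> F"
    have t: "t \<in> L" "t \<in> \<Gamma> i" using insert.prems by auto
    have TL: "?T \<subseteq> L" using insert.prems by auto
    \<comment> \<open>By \<open>right\<close> a commutator with t \<in> \<Gamma> i lies in \<Gamma>
      (Suc i), so it is among the letters already adjoined; by \<open>left\<close> it is deeper than
      x.\<close>
    have comm: "inv x \<otimes> inv t \<otimes> x \<otimes> t \<in> ?T \<and> inv x \<otimes> inv t \<otimes> x \<otimes> t \<in> \<Gamma> (Suc k)"
      if "x \<in> ?T" "x \<in> \<Gamma> k" for x k
      using that t TL closed[of x t] left[of x t k] right[of x t i] by auto
    have "poly_growth G (insert t ?T)"
    proof (rule poly_growth_insert[where c = c])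
      show "finite ?T" "?T \<subseteq> carrier G" "\<one> \<in> ?T"
        using L one insert.hyps TL by auto
      show "poly_growth G ?T" using insert by auto
      show "t \<in> carrier G" using t L by auto
      fix x :: 'a and a :: nat
      assume x: "x \<in> ?T"
      show "inv (t [^] a) \<otimes> x \<otimes> t [^] a \<in> set_power G ?T ((a + 1) ^ c)"
        by (rule conj_pow_in_set_power[where \<Gamma> = \<Gamma> and c = c and i = 0])
          (use L one TL t x c comm in \<open>auto\<close>)
    qed
    then show ?case by (simp add: Un_commute)
  qed
  \<comment> \<open>The filtration is climbed from the trivial \<Gamma> c to \<Gamma> 0, which
    contains L.\<close>
  have "poly_growth G (L \<inter> \<Gamma> (c - j))" for j
  proof (induction j)
    case 0
    have "L \<inter> \<Gamma> (c - 0) = {\<one>}" using c L by auto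
    moreover have "set_power G {\<one>} n = {\<one>}" for n
      by (induction n) (auto simp: set_mult_def)
    ultimately show ?case unfolding poly_growth_def by (intro exI[of _ 1] exI[of _ 0]) simp
  next
    case (Suc j)
    show ?case
    proof (cases "j < c")
      case True
      then have eq: "c - j = Suc (c - Suc j)" by auto
      have "(L \<inter> \<Gamma> (Suc (c - Suc j))) \<union> (L \<inter> \<Gamma> (c - Suc j)) = L \<inter> \<Gamma> (c - Suc j)"
        using dec by auto
      then show ?thesis
        using step[of "c - Suc j" "L \<inter> \<Gamma> (c - Suc j)"] Suc.IH L(1) unfolding eq by auto
    qed (use Suc.IH in simp)
  qed
  from this[of c] show ?thesis using L(4) by (simp add: Int_absorb2)
qed

section \<open>The lower central series and growth of nilpotent groups\<close>

lemma lower_central_subgroup: "subgroup (lower_central G n) G"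
proof (induction n)
  case 0
  then show ?case by (simp add: subgroup_self)
next
  case (Suc n)
  have "commutator_set G (lower_central G n) (carrier G) \<subseteq> carrier G"
    using subgroup.subset[OF Suc.IH] by (auto simp: commutator_set_def subset_iff)
  then show ?case by (simp add: generate_is_subgroup)
qed

lemma lower_central_Suc_subset: "lower_central G (Suc n) \<subseteq> lower_central G n"
proof (induction n)
  case 0
  then show ?case using subgroup.subset[OF lower_central_subgroup[of "Suc 0"]] by simp
next
  case (Suc n)
  then have "commutator_set G (lower_central G (Suc n)) (carrier G)
      \<subseteq> commutator_set G (lower_central G n) (carrier G)"
    unfolding commutator_set_def by blast
  then show ?case using mono_generate by (metis lower_central.simps(2))
qed

text \<open>\<open>lower_central\<close> is generated by commutators of the form x y x^-1 y^-1,
  hence the passage to inverses; the second element is the inverse of the first.\<close>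

lemma commutator_in_lower_central:
  assumes x: "x \<in> lower_central G i" and y: "y \<in> carrier G"
  shows "inv x \<otimes> inv y \<otimes> x \<otimes> y \<in> lower_central G (Suc i)"
    "inv y \<otimes> inv x \<otimes> y \<otimes> x \<in> lower_central G (Suc i)"
proof -
  have xG: "x \<in> carrier G" using x subgroup.subset[OF lower_central_subgroup] by auto
  have "inv x \<in> lower_central G i"
    using subgroup.m_inv_closed[OF lower_central_subgroup x] .
  then have "inv x \<otimes> inv y \<otimes> inv (inv x) \<otimes> inv (inv y)
      \<in> commutator_set G (lower_central G i) (carrier G)"
    unfolding commutator_set_def using y by blast
  then show 1: "inv x \<otimes> inv y \<otimes> x \<otimes> y \<in> lower_central G (Suc i)"
    using xG y generate.incl by (metis inv_inv lower_central.simps(2))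
  have "inv (inv x \<otimes> inv y \<otimes> x \<otimes> y) = inv y \<otimes> inv x \<otimes> y \<otimes> x"
    using xG y by (simp add: inv_mult_group m_assoc)
  then show "inv y \<otimes> inv x \<otimes> y \<otimes> x \<in> lower_central G (Suc i)"
    using subgroup.m_inv_closed[OF lower_central_subgroup 1] by simp
qed

text \<open>Closing S under commutators stops after finitely many rounds, since elements that are
  new in round j lie in \<open>lower_central G j\<close>. The finite closure has polynomial growth,
  and it contains S.\<close>

lemma nilpotent_poly_growth:
  assumes nil: "nilpotent_group G" and S: "finite S" "S \<subseteq> carrier G"
  shows "poly_growth G S"
proof -
  obtain c where c: "lower_central G c = {\<one>}" using nil by (auto simp: nilpotent_group_def)
  define A where "A j = ((\<lambda>B. B \<union> (\<lambda>(x, y). inv x \<otimes> inv y \<otimes> x \<otimes> y) ` (B \<times> B)) ^^ j)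
    (insert \<one> S)" for j
  have A_Suc: "A (Suc j) = A j \<union> (\<lambda>(x, y). inv x \<otimes> inv y \<otimes> x \<otimes> y) ` (A j \<times> A j)" for j
    unfolding A_def by simp
  have fin: "finite (A j)" for j
    by (induction j) (use S in \<open>auto simp: A_Suc A_def[of 0]\<close>)
  have car: "A j \<subseteq> carrier G" for j
    by (induction j) (use S in \<open>auto simp: A_Suc A_def[of 0] subset_iff\<close>)
  have sub: "insert \<one> S \<subseteq> A j" for j
    by (induction j) (auto simp: A_Suc A_def[of 0])
  have comm: "inv x \<otimes> inv y \<otimes> x \<otimes> y \<in> lower_central G (Suc i)"
    if "x \<in> lower_central G i \<or> y \<in> lower_central G i" "x \<in> carrier G" "y \<in> carrier G" for x y i
    using that commutator_in_lower_central by blast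
  have grow: "A (Suc j) \<subseteq> A j \<union> lower_central G (Suc j)" for j
  proof (induction j)
    case 0
    show ?case using car[of 0] comm[of _ 0] by (auto simp: A_Suc)
  next
    case (Suc j)
    show ?case
    proof
      fix z assume "z \<in> A (Suc (Suc j))"
      then consider "z \<in> A (Suc j)"
        | x y where "x \<in> A (Suc j)" "y \<in> A (Suc j)" "z = inv x \<otimes> inv y \<otimes> x \<otimes> y"
        unfolding A_Suc[of "Suc j"] by auto
      then show "z \<in> A (Suc j) \<union> lower_central G (Suc (Suc j))"
      proof cases
        case 2
        show ?thesis
        proof (cases "x \<in> A j \<and> y \<in> A j")
          case True
          then show ?thesis using 2 by (auto simp: A_Suc[of j])
        next
          case False
          \<comment> \<open>One of x, y is new in the last round, hence deep, and the commutator is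
            one step deeper.\<close>
          then have "x \<in> lower_central G (Suc j) \<or> y \<in> lower_central G (Suc j)"
            using 2 Suc.IH by blast
          then show ?thesis using comm 2 car by blast
        qed
      qed auto
    qed
  qed
  \<comment> \<open>Round \<open>Suc c\<close> could add only \<one>, which is present from the
    start.\<close>
  have "A (Suc c) \<subseteq> A c"
  proof -
    have "lower_central G (Suc c) \<subseteq> {\<one>}" using lower_central_Suc_subset[of c] c by simp
    then show ?thesis using grow[of c] sub[of c] by auto
  qed
  then have closed: "inv x \<otimes> inv y \<otimes> x \<otimes> y \<in> A c" if "x \<in> A c" "y \<in> A c" for x y
    using that by (auto simp: A_Suc)
  have "poly_growth G (A c)"
  proof (rule poly_growth_commutator_closed[where \<Gamma> = "lower_central G" and c = c])
    show "\<one> \<in> lower_central G i" for i using subgroup.one_closed[OF lower_central_subgroup] .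
    show "inv x \<otimes> inv y \<otimes> x \<otimes> y \<in> lower_central G (Suc i)"
      if "x \<in> A c" "y \<in> A c" "x \<in> lower_central G i" for x y i
      using that car comm by blast
    show "inv x \<otimes> inv y \<otimes> x \<otimes> y \<in> lower_central G (Suc i)"
      if "x \<in> A c" "y \<in> A c" "y \<in> lower_central G i" for x y i
      using that car comm by blast
  qed (use fin car sub closed c lower_central_Suc_subset in \<open>auto simp del: lower_central.simps(2)\<close>)
  then obtain C d where Cd: "\<And>n. card (set_power G (A c) n) \<le> C * (n + 1) ^ d"
    unfolding poly_growth_def by auto
  have "card (set_power G S n) \<le> card (set_power G (A c) n)" for n
    using set_power_mono_base[of S "A c" n] sub[of c] finite_set_power[OF fin[of c]]
    by (intro card_mono) auto
  then show ?thesis unfolding poly_growth_def using Cd order_trans by blast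
qed

end

section \<open>Finite sets of bounded expansion\<close>

text \<open>D depends on H only, while V can be made to contain any finite part of H. The exponent
  is 11 = 10 + 1: markers will be separated by the tenth power of V, and translates of V by elements
  of that power stay in the eleventh.\<close>

definition tame :: "('a, 'b) monoid_scheme \<Rightarrow> 'a set \<Rightarrow> nat \<Rightarrow> bool" where
  "tame G H D \<longleftrightarrow> (\<forall>Q. finite Q \<longrightarrow> Q \<subseteq> H \<longrightarrow>
     (\<exists>V. finite V \<and> Q \<subseteq> V \<and> V \<subseteq> H \<and> \<one>\<^bsub>G\<^esub> \<in> V \<and> (\<forall>v\<in>V. inv\<^bsub>G\<^esub> v \<in> V) \<and>
       card (set_power G V 11) \<le> D * card V))"

text \<open>Otherwise, beyond m0, each multiplication of the argument by 11 multiplies f by at least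
  11^d + 1, whereas the polynomial bound allows only a factor 11^d per step in the long run.\<close>

lemma poly_bounded_doubling:
  fixes f :: "nat \<Rightarrow> nat"
  assumes f: "\<And>n. f n \<le> C * (n + 1) ^ d" and pos: "\<And>n. f n > 0"
  shows "\<exists>m\<ge>m0. f (11 * m) \<le> (11 ^ d + 1) * f m"
proof (rule ccontr)
  assume "\<not> ?thesis"
  then have step: "f (11 * m) \<ge> (11 ^ d + 1) * f m" if "m \<ge> m0" for m
    using that by (meson nle_le)
  define m1 where "m1 = m0 + 1"
  have lower: "f (11 ^ j * m1) \<ge> (11 ^ d + 1) ^ j" for j
  proof (induction j)
    case 0
    then show ?case using pos[of m1] by simp
  next
    case (Suc j)
    have "11 ^ j * m1 \<ge> 1 * m0" unfolding m1_def by (intro mult_mono) auto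
    then have "(11 ^ d + 1) * f (11 ^ j * m1) \<le> f (11 * (11 ^ j * m1))"
      using step[of "11 ^ j * m1"] by simp
    moreover have "(11 ^ d + 1) * (11 ^ d + 1) ^ j \<le> (11 ^ d + 1) * f (11 ^ j * m1)"
      using Suc by (intro mult_left_mono) auto
    ultimately show ?case by (simp add: mult.assoc)
  qed
  define K where "K = C * (m1 + 1) ^ d"
  have upper: "f (11 ^ j * m1) \<le> K * (11 ^ d) ^ j" for j
  proof -
    have "11 ^ j * m1 + 1 \<le> 11 ^ j * (m1 + 1)" by simp
    then have "(11 ^ j * m1 + 1) ^ d \<le> (11 ^ j * (m1 + 1)) ^ d" by (intro power_mono) auto
    also have "\<dots> = (m1 + 1) ^ d * (11 ^ d) ^ j"
      by (simp only: power_mult_distrib power_mult[symmetric] mult.commute)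
    finally show ?thesis using f[of "11 ^ j * m1"] unfolding K_def
      by (metis mult.assoc mult_le_mono2 order_trans)
  qed
  \<comment> \<open>The quotient of the two rates exceeds 1, so its powers pass the constant
    K.\<close>
  have "\<exists>j. real K < (1 + 1 / 11 ^ d) ^ j"
    by (rule real_arch_pow) simp
  then obtain j where j: "real K < (1 + 1 / 11 ^ d) ^ j" by blast
  have "real ((11 ^ d + 1) ^ j) = (1 + 1 / 11 ^ d) ^ j * (11 ^ d) ^ j"
    by (simp add: power_mult_distrib[symmetric] field_simps)
  also have "\<dots> > real K * (11 ^ d) ^ j" using j by simp
  finally have "real (K * (11 ^ d) ^ j) < real ((11 ^ d + 1) ^ j)" by simp
  then have "K * (11 ^ d) ^ j < (11 ^ d + 1) ^ j" by (simp only: of_nat_less_iff)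
  then show False using lower[of j] upper[of j] by linarith
qed

context group
begin

text \<open>The powers of a symmetric generating set B exhaust the subgroup, and polynomial growth
  gives arbitrarily large m at which passing from m to 11 m costs a bounded factor. V is the m-th
  power of B.\<close>

lemma nilpotent_tame:
  assumes S: "finite S" "S \<subseteq> carrier G" and nil: "nilpotent_group (subgroup_generated G S)"
  shows "\<exists>D. tame G (generate G S) D"
proof -
  interpret K: group "subgroup_generated G S" by simp
  define H where "H = generate G S"
  have H: "subgroup H G" unfolding H_def using generate_is_subgroup[OF S(2)] .
  have carK: "carrier (subgroup_generated G S) = H"
    unfolding H_def carrier_subgroup_generated using S by (simp add: Int_absorb1)
  define B where "B = insert \<one> (S \<union> m_inv G ` S)"
  have BG: "finite B" "B \<subseteq> carrier G" "\<one> \<in> B" "\<And>v. v \<in> B \<Longrightarrow> inv v \<in> B"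
    using S unfolding B_def by auto
  have BH: "B \<subseteq> H"
    unfolding B_def H_def by (auto intro: generate.intros)
  have "poly_growth (subgroup_generated G S) B"
    using K.nilpotent_poly_growth[OF nil] BG BH carK by auto
  then obtain C d where Cd: "\<And>n. card (set_power G B n) \<le> C * (n + 1) ^ d"
    unfolding poly_growth_def by auto
  have "tame G H (11 ^ d + 1)"
    unfolding tame_def
  proof (intro allI impI)
    fix Q assume Q: "finite Q" "Q \<subseteq> H"
    have "\<exists>n. x \<in> set_power G B n" if "x \<in> Q" for x
    proof -
      have "x \<in> generate G B"
        using that Q mono_generate[of S B] unfolding H_def B_def by auto
      then show ?thesis using set_power_generate BG by blast
    qed
    then obtain l where l: "\<And>x. x \<in> Q \<Longrightarrow> x \<in> set_power G B (l x)" by metis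
    \<comment> \<open>From length m0 on, every power of B contains Q; the inserted 0 covers the
      empty Q.\<close>
    define m0 where "m0 = Max (insert 0 (l ` Q))"
    have Qm0: "x \<in> set_power G B m" if "x \<in> Q" "m0 \<le> m" for x m
    proof -
      have "l x \<le> m0" unfolding m0_def using that Q by (intro Max_ge) auto
      then show ?thesis using l[OF that(1)] set_power_mono[OF BG(2,3), of "l x" m] that by auto
    qed
    have pos: "card (set_power G B n) > 0" for n
      using one_in_set_power[OF BG(3)] finite_set_power[OF BG(1)] by (auto simp: card_gt_0_iff)
    obtain m where m: "m0 \<le> m" "card (set_power G B (11 * m)) \<le> (11 ^ d + 1) * card (set_power G B m)"
      using poly_bounded_doubling[of "\<lambda>n. card (set_power G B n)" C d m0, OF Cd pos] by auto
    define V where "V = set_power G B m"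
    have "card (set_power G V 11) \<le> card (set_power G B (11 * m))"
      unfolding V_def using set_power_set_power[OF BG(2), of m 11] finite_set_power[OF BG(1)]
      by (intro card_mono) (auto simp: mult.commute)
    then have "card (set_power G V 11) \<le> (11 ^ d + 1) * card V" using m(2) V_def by simp
    moreover have "finite V" "Q \<subseteq> V" "V \<subseteq> H" "\<one> \<in> V" "\<forall>v\<in>V. inv v \<in> V"
      unfolding V_def
      using finite_set_power[OF BG(1)] Qm0[OF _ m(1)] set_power_subset_subgroup[OF H BH]
        one_in_set_power[OF BG(3)] set_power_inv[OF BG(2)] BG(4) by auto
    ultimately show "\<exists>V. finite V \<and> Q \<subseteq> V \<and> V \<subseteq> H \<and> \<one> \<in> V \<and> (\<forall>v\<in>V. inv v \<in> V) \<and>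
       card (set_power G V 11) \<le> (11 ^ d + 1) * card V" by blast
  qed
  then show ?thesis unfolding H_def by blast
qed

end

section \<open>Borel group actions and separated markers\<close>

text \<open>\<open>separating\<close> is what is retained of the standard Borel structure: it makes
  fixed point sets and graphs Borel and allows Borel choices of markers.\<close>

locale borel_action =
  fixes G :: "('g, 'b) monoid_scheme" (structure) and M :: "'x measure" and \<phi> :: "'g \<Rightarrow> 'x \<Rightarrow> 'x"
  assumes action: "group_action G (space M) \<phi>"
    and countable_group: "countable (carrier G)"
    and measurable_action: "\<And>g. g \<in> carrier G \<Longrightarrow> \<phi> g \<in> M \<rightarrow>\<^sub>M M"
    and separating: "\<exists>\<B>. countable \<B> \<and> \<B> \<subseteq> sets M \<and>
      (\<forall>x\<in>space M. \<forall>F. finite F \<longrightarrow> F \<subseteq> space M \<longrightarrow> x \<notin> F \<longrightarrow> (\<exists>B\<in>\<B>. x \<in> B \<and> B \<inter> F = {}))"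
begin

sublocale group_action G "space M" \<phi> by (rule action)

sublocale group G using group_hom group_hom.axioms(1) by blast

lemma act_closed [simp]: "g \<in> carrier G \<Longrightarrow> x \<in> space M \<Longrightarrow> \<phi> g x \<in> space M"
  using element_image by blast

lemma act_mult: "g \<in> carrier G \<Longrightarrow> h \<in> carrier G \<Longrightarrow> x \<in> space M \<Longrightarrow> \<phi> g (\<phi> h x) = \<phi> (g \<otimes> h) x"
  using composition_rule by simp

lemma act_one [simp]: "x \<in> space M \<Longrightarrow> \<phi> \<one> x = x"
  using id_eq_one by (metis restrict_apply')

lemma act_inv: "g \<in> carrier G \<Longrightarrow> x \<in> space M \<Longrightarrow> \<phi> (inv g) (\<phi> g x) = x"
  by (simp add: act_mult)

text \<open>Borel sets as predicates, of which only the trace on \<open>space M\<close>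
  counts.\<close>

definition borel_pred :: "('x \<Rightarrow> bool) \<Rightarrow> bool" where
  "borel_pred P \<longleftrightarrow> {x \<in> space M. P x} \<in> sets M"

lemma borel_pred_const: "borel_pred (\<lambda>x. c)"
  and borel_pred_not: "borel_pred P \<Longrightarrow> borel_pred (\<lambda>x. \<not> P x)"
  and borel_pred_conj: "borel_pred P \<Longrightarrow> borel_pred Q \<Longrightarrow> borel_pred (\<lambda>x. P x \<and> Q x)"
  and borel_pred_disj: "borel_pred P \<Longrightarrow> borel_pred Q \<Longrightarrow> borel_pred (\<lambda>x. P x \<or> Q x)"
  and borel_pred_imp: "borel_pred P \<Longrightarrow> borel_pred Q \<Longrightarrow> borel_pred (\<lambda>x. P x \<longrightarrow> Q x)"
  and borel_pred_Ex: "(\<And>i :: nat. borel_pred (A i)) \<Longrightarrow> borel_pred (\<lambda>x. \<exists>i. A i x)"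
  and borel_pred_All: "(\<And>i :: nat. borel_pred (A i)) \<Longrightarrow> borel_pred (\<lambda>x. \<forall>i. A i x)"
  and borel_pred_Ball: "countable I \<Longrightarrow> (\<And>i. i \<in> I \<Longrightarrow> borel_pred (B i)) \<Longrightarrow> borel_pred (\<lambda>x. \<forall>i\<in>I. B i x)"
  and borel_pred_Bex: "countable I \<Longrightarrow> (\<And>i. i \<in> I \<Longrightarrow> borel_pred (B i)) \<Longrightarrow> borel_pred (\<lambda>x. \<exists>i\<in>I. B i x)"
  and borel_pred_mem: "C \<in> sets M \<Longrightarrow> borel_pred (\<lambda>x. x \<in> C)"
  unfolding borel_pred_def
proof -
  show "{x \<in> space M. x \<in> C} \<in> sets M" if "C \<in> sets M"
    using that sets.Int[of "space M" M C] by (simp add: Int_def)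
qed (intro sets.sets_Collect sets.sets_Collect_countable_All' sets.sets_Collect_countable_Ex'; assumption)+

lemma borel_pred_act:
  assumes "borel_pred P" "g \<in> carrier G"
  shows "borel_pred (\<lambda>x. P (\<phi> g x))"
proof -
  have "{x \<in> space M. P (\<phi> g x)} = \<phi> g -` {x \<in> space M. P x} \<inter> space M"
    using assms(2) by auto
  then show ?thesis
    using measurable_sets[OF measurable_action[OF assms(2)]] assms(1) unfolding borel_pred_def by metis
qed

lemma obtain_separating_sequence:
  obtains b :: "nat \<Rightarrow> 'x set" where "\<And>n. b n \<in> sets M"
    "\<And>x F. x \<in> space M \<Longrightarrow> finite F \<Longrightarrow> F \<subseteq> space M \<Longrightarrow> x \<notin> F \<Longrightarrow> \<exists>n. x \<in> b n \<and> b n \<inter> F = {}"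
proof -
  obtain \<B> where B: "countable \<B>" "\<B> \<subseteq> sets M"
    "\<And>x F. x \<in> space M \<Longrightarrow> finite F \<Longrightarrow> F \<subseteq> space M \<Longrightarrow> x \<notin> F \<Longrightarrow> \<exists>B\<in>\<B>. x \<in> B \<and> B \<inter> F = {}"
    using separating by metis
  \<comment> \<open>The empty set makes the family nonempty, so that it is the range of its
    enumeration.\<close>
  define b where "b = from_nat_into (insert {} \<B>)"
  have r: "range b = insert {} \<B>"
    unfolding b_def using B(1) by (intro range_from_nat_into) auto
  show ?thesis
  proof (rule that[of b])
    show "b n \<in> sets M" for n using r B(2) by (metis insert_subset rangeI sets.empty_sets subset_iff)
    show "\<exists>n. x \<in> b n \<and> b n \<inter> F = {}"
      if "x \<in> space M" "finite F" "F \<subseteq> space M" "x \<notin> F" for x F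
    proof -
      obtain C where "C \<in> \<B>" "x \<in> C" "C \<inter> F = {}" using B(3)[OF \<open>x \<in> space M\<close> \<open>finite F\<close> \<open>F \<subseteq> space M\<close> \<open>x \<notin> F\<close>] by auto
      moreover then have "C \<in> range b" using r by simp
      ultimately show ?thesis by auto
    qed
  qed
qed

text \<open>The countably many sets \<open>b n\<close> separate points, so equality of
  \<open>\<phi> g x\<close> and x is a countable conjunction of Borel conditions.\<close>

lemma borel_pred_fixed:
  assumes g: "g \<in> carrier G"
  shows "borel_pred (\<lambda>x. \<phi> g x = x)"
proof -
  obtain b :: "nat \<Rightarrow> 'x set" where b: "\<And>n. b n \<in> sets M"
    "\<And>x F. x \<in> space M \<Longrightarrow> finite F \<Longrightarrow> F \<subseteq> space M \<Longrightarrow> x \<notin> F \<Longrightarrow> \<exists>n. x \<in> b n \<and> b n \<inter> F = {}"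
    using obtain_separating_sequence by blast
  have "(\<phi> g x = x) = (\<forall>n. \<phi> g x \<in> b n \<longrightarrow> x \<in> b n)" if "x \<in> space M" for x
    using b(2)[of "\<phi> g x" "{x}"] that g by auto
  then have "{x \<in> space M. \<phi> g x = x} = {x \<in> space M. \<forall>n. \<phi> g x \<in> b n \<longrightarrow> x \<in> b n}" by auto
  moreover have "borel_pred (\<lambda>x. \<forall>n. \<phi> g x \<in> b n \<longrightarrow> x \<in> b n)"
    by (intro borel_pred_All borel_pred_imp borel_pred_mem b
        borel_pred_act[of "\<lambda>x. x \<in> b _"] g)
  ultimately show ?thesis unfolding borel_pred_def by simp
qed

section \<open>Borel choice of separated markers\<close>

primrec greedy :: "'g set \<Rightarrow> (nat \<Rightarrow> 'x \<Rightarrow> bool) \<Rightarrow> nat \<Rightarrow> 'x \<Rightarrow> bool" where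
  "greedy W Y 0 = (\<lambda>x. False)"
| "greedy W Y (Suc n) = (\<lambda>x. greedy W Y n x \<or> (Y n x \<and> \<not> (\<exists>g\<in>W. greedy W Y n (\<phi> g x))))"

lemma greedy_mono: "greedy W Y n x \<Longrightarrow> n \<le> m \<Longrightarrow> greedy W Y m x"
  by (induction m) (auto elim: le_SucE)

lemma borel_pred_greedy:
  assumes "finite W" "W \<subseteq> carrier G" "\<And>n. borel_pred (Y n)"
  shows "borel_pred (greedy W Y n)"
proof (induction n)
  case (Suc n)
  then have "borel_pred (\<lambda>x. greedy W Y n (\<phi> g x))" if "g \<in> W" for g
    using that assms(2) by (intro borel_pred_act) auto
  then have "borel_pred (\<lambda>x. \<exists>g\<in>W. greedy W Y n (\<phi> g x))"
    using assms(1) by (intro borel_pred_Bex) (auto intro: countable_finite)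
  then show ?case unfolding greedy.simps
    by (intro borel_pred_disj borel_pred_conj borel_pred_not Suc assms(3))
qed (simp add: borel_pred_const)

text \<open>Y is covered by countably many Borel sets \<open>S n\<close> in which W-related points
  coincide, and the greedy choice runs through them. The action need not be free, so separation says
  that W-related markers are equal, not that the group element is \<one>.\<close>

lemma maximal_separated:
  assumes W: "finite W" "W \<subseteq> carrier G" "\<one> \<in> W" "\<And>g. g \<in> W \<Longrightarrow> inv g \<in> W"
    and Y: "borel_pred Y"
  shows "\<exists>Z. borel_pred Z \<and> (\<forall>x. Z x \<longrightarrow> Y x) \<and>
    (\<forall>x\<in>space M. \<forall>g\<in>W. Z x \<longrightarrow> Z (\<phi> g x) \<longrightarrow> \<phi> g x = x) \<and>
    (\<forall>x\<in>space M. Y x \<longrightarrow> (\<exists>g\<in>W. Z (\<phi> g x)))"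
proof -
  obtain b :: "nat \<Rightarrow> 'x set" where b: "\<And>n. b n \<in> sets M"
    "\<And>x F. x \<in> space M \<Longrightarrow> finite F \<Longrightarrow> F \<subseteq> space M \<Longrightarrow> x \<notin> F \<Longrightarrow> \<exists>n. x \<in> b n \<and> b n \<inter> F = {}"
    using obtain_separating_sequence by blast
  \<comment> \<open>Here \<open>b n\<close> isolates x from its other W-translates; by separation
    every x in Y has such an n.\<close>
  define S where "S n x \<longleftrightarrow> Y x \<and> x \<in> b n \<and> (\<forall>g\<in>W. \<phi> g x = x \<or> \<phi> g x \<notin> b n)" for n x
  have S: "borel_pred (S n)" for n
    unfolding S_def using W
    by (intro borel_pred_conj borel_pred_Ball borel_pred_disj borel_pred_not Y borel_pred_mem b
        borel_pred_fixed borel_pred_act[of "\<lambda>x. x \<in> b n"]) (auto intro: countable_finite)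
  let ?U = "greedy W S"
  have sep: "\<phi> g x = x" if "x \<in> space M" "g \<in> W" "?U n x" "?U n (\<phi> g x)" for n x g
    using that
  proof (induction n arbitrary: x g)
    case (Suc n)
    have inv_act: "\<phi> (inv g) (\<phi> g x) = x" using act_inv Suc.prems W by blast
    show ?case
    proof (cases "?U n x")
      case True
      \<comment> \<open>The earlier choice of x blocks \<open>\<phi> g x\<close> through
        \<open>inv g\<close>, so \<open>\<phi> g x\<close> cannot be new in this round.\<close>
      then have "\<exists>h\<in>W. ?U n (\<phi> h (\<phi> g x))" using inv_act W Suc.prems by metis
      then have "?U n (\<phi> g x)" using Suc.prems(4) by auto
      then show ?thesis using Suc.IH True Suc.prems by blast
    next
      case False
      then have "S n x" "\<not> (\<exists>g\<in>W. ?U n (\<phi> g x))" using Suc.prems(3) by auto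
      moreover then have "S n (\<phi> g x)" using Suc.prems by auto
      ultimately show ?thesis unfolding S_def using Suc.prems by auto
    qed
  qed simp
  have sub: "Y x" if "?U n x" for n x
    using that by (induction n) (auto simp: S_def)
  have max: "\<exists>n. \<exists>g\<in>W. ?U n (\<phi> g x)" if x: "x \<in> space M" "Y x" for x
  proof -
    have "\<exists>n. x \<in> b n \<and> b n \<inter> ((\<lambda>g. \<phi> g x) ` W - {x}) = {}"
      using x W by (intro b(2)) auto
    then obtain n where "x \<in> b n" "b n \<inter> ((\<lambda>g. \<phi> g x) ` W - {x}) = {}" by auto
    then have "S n x" unfolding S_def using x by auto
    then have "?U (Suc n) x \<or> (\<exists>g\<in>W. ?U n (\<phi> g x))" by auto
    then show ?thesis using W(3) act_one[OF x(1)] by metis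
  qed
  show ?thesis
  proof (intro exI[of _ "\<lambda>x. \<exists>n. ?U n x"] conjI ballI allI impI)
    show "borel_pred (\<lambda>x. \<exists>n. ?U n x)"
      by (intro borel_pred_Ex borel_pred_greedy W S)
    fix x g assume "x \<in> space M" "g \<in> W" "\<exists>n. ?U n x" "\<exists>n. ?U n (\<phi> g x)"
    moreover then obtain n m where "?U n x" "?U m (\<phi> g x)" by auto
    then have "?U (max n m) x" "?U (max n m) (\<phi> g x)" by (auto intro: greedy_mono)
    ultimately show "\<phi> g x = x" using sep by blast
  qed (use sub max in blast)+
qed

text \<open>The markers \<open>Z i\<close> are chosen greedily; a point missed by \<open>D\<close> of them would give
  \<open>D + 1\<close> disjoint translates of \<open>V\<close> inside its eleventh power.\<close>

lemma separated_markers: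
  assumes V: "finite V" "V \<subseteq> carrier G" "\<one> \<in> V" "\<And>g. g \<in> V \<Longrightarrow> inv g \<in> V"
    and doubling: "card (set_power G V 11) \<le> D * card V"
  shows "\<exists>Z. (\<forall>i. borel_pred (Z i)) \<and>
    (\<forall>i. \<forall>x\<in>space M. \<forall>g\<in>set_power G V 10. Z i x \<longrightarrow> Z i (\<phi> g x) \<longrightarrow> \<phi> g x = x) \<and>
    (\<forall>x\<in>space M. \<exists>i<D. \<exists>g\<in>set_power G V 2. Z i (\<phi> g x))"
proof -
  let ?P = "set_power G V"
  have P: "finite (?P n)" "?P n \<subseteq> carrier G" "\<one> \<in> ?P n" "\<And>g. g \<in> ?P n \<Longrightarrow> inv g \<in> ?P n" for n
    by (rule finite_set_power[OF V(1)], rule set_power_closed[OF V(2)], rule one_in_set_power[OF V(3)],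
        rule set_power_inv[OF V(2,4)])
  define \<Psi> where "\<Psi> Y Z \<longleftrightarrow> borel_pred Z \<and> (\<forall>x. Z x \<longrightarrow> Y x) \<and>
    (\<forall>x\<in>space M. \<forall>g\<in>?P 10. Z x \<longrightarrow> Z (\<phi> g x) \<longrightarrow> \<phi> g x = x) \<and>
    (\<forall>x\<in>space M. Y x \<longrightarrow> (\<exists>g\<in>?P 10. Z (\<phi> g x)))" for Y Z
  define S where "S Y = (SOME Z. \<Psi> Y Z)" for Y
  have "\<exists>Z. \<Psi> Y Z" if "borel_pred Y" for Y
    unfolding \<Psi>_def by (rule maximal_separated[OF P(1-3) _ that]) (rule P(4))
  then have \<Psi>: "\<Psi> Y (S Y)" if "borel_pred Y" for Y
    unfolding S_def by (rule someI_ex) (rule that)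
  have S1: "borel_pred (S Y)" if "borel_pred Y" for Y
    using \<Psi>[OF that] unfolding \<Psi>_def by (elim conjE)
  have S2: "Y x" if "borel_pred Y" "S Y x" for Y x
    using \<Psi>[OF that(1)] that(2) unfolding \<Psi>_def by (elim conjE) (erule allE, erule mp)
  have S3: "\<phi> g x = x"
    if "borel_pred Y" "x \<in> space M" "g \<in> ?P 10" "S Y x" "S Y (\<phi> g x)" for Y x g
    using \<Psi>[OF that(1)] that(2-) unfolding \<Psi>_def by (elim conjE) (drule (1) bspec, drule (1) bspec, iprover)
  have S4: "\<exists>g\<in>?P 10. S Y (\<phi> g x)" if "borel_pred Y" "x \<in> space M" "Y x" for Y x
    using \<Psi>[OF that(1)] that(2-) unfolding \<Psi>_def by (elim conjE) (drule (1) bspec, drule (1) bspec, iprover)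
  \<comment> \<open>\<open>N i\<close> holds the points from which the second power of V reaches no
    marker of the first i families; family i is a maximal separated subset of
    \<open>N i\<close>.\<close>
  define N where "N = rec_nat (\<lambda>x. True) (\<lambda>i N x. N x \<and> (\<forall>g\<in>?P 2. \<not> S N (\<phi> g x)))"
  have N0: "N 0 = (\<lambda>x. True)" and NS: "N (Suc i) = (\<lambda>x. N i x \<and> (\<forall>g\<in>?P 2. \<not> S (N i) (\<phi> g x)))" for i
    unfolding N_def by simp_all
  have bN: "borel_pred (N i)" for i
  proof (induction i)
    case (Suc i)
    have "borel_pred (\<lambda>x. S (N i) (\<phi> g x))" if "g \<in> ?P 2" for g
      using that P(2) S1[OF Suc] by (intro borel_pred_act) auto
    then have "borel_pred (\<lambda>x. \<forall>g\<in>?P 2. \<not> S (N i) (\<phi> g x))"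
      using P(1) by (intro borel_pred_Ball borel_pred_not) (auto intro: countable_finite)
    then show ?case unfolding NS using Suc by (intro borel_pred_conj)
  qed (simp add: N0 borel_pred_const)
  have N_le: "N i x" if "N j x" "i \<le> j" for i j x
    using that by (induction j) (auto simp: NS elim: le_SucE)
  have cover: "\<exists>i<D. \<exists>g\<in>?P 2. S (N i) (\<phi> g x)" if x: "x \<in> space M" for x
  proof (rule ccontr)
    assume "\<not> ?thesis"
    then have "N i x" if "i \<le> D" for i
      using that by (induction i) (auto simp: N0 NS)
    then have ND: "N D x" by simp
    \<comment> \<open>For i < D maximality gives a marker of family i near x; the extra index D is
      served by x itself.\<close>
    have "\<exists>g. g \<in> ?P 10 \<and> (i < D \<longrightarrow> S (N i) (\<phi> g x)) \<and> N i (\<phi> g x)" if "i \<in> {..D}" for i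
    proof (cases "i < D")
      case True
      then have "N i x" using N_le[OF ND] by simp
      then show ?thesis using S2[OF bN] S4[OF bN x] by blast
    next
      case False
      then show ?thesis using ND that x P(3) by (intro exI[of _ \<one>]) auto
    qed
    then have "\<forall>i\<in>{..D}. \<exists>g. g \<in> ?P 10 \<and> (i < D \<longrightarrow> S (N i) (\<phi> g x)) \<and> N i (\<phi> g x)" by blast
    from bchoice[OF this] obtain h where h_all: "\<forall>i\<in>{..D}. h i \<in> ?P 10 \<and>
      (i < D \<longrightarrow> S (N i) (\<phi> (h i) x)) \<and> N i (\<phi> (h i) x)" by blast
    then have h: "\<And>i. i \<le> D \<Longrightarrow> h i \<in> ?P 10" "\<And>i. i < D \<Longrightarrow> S (N i) (\<phi> (h i) x)"
      "\<And>i. i \<le> D \<Longrightarrow> N i (\<phi> (h i) x)"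
      by simp_all
    have hG: "h i \<in> carrier G" if "i \<le> D" for i using h(1)[OF that] P(2) by auto
    \<comment> \<open>A coincidence would let an element of the second power of V carry
      \<open>\<phi> (h j) x\<close>, a point of \<open>N (Suc i)\<close>, onto a marker of family
      i.\<close>
    have neq: "v \<otimes> h i \<noteq> w \<otimes> h j" if ij: "i < j" "j \<le> D" and vw: "v \<in> V" "w \<in> V" for i j v w
    proof
      assume eq: "v \<otimes> h i = w \<otimes> h j"
      have vG: "v \<in> carrier G" "w \<in> carrier G" using V vw by auto
      have "N (Suc i) (\<phi> (h j) x)" using h(3)[of j] N_le ij by (meson Suc_leI)
      then have no: "\<not> S (N i) (\<phi> g (\<phi> (h j) x))" if "g \<in> ?P 2" for g
        using that unfolding NS by auto
      have "inv v \<otimes> w \<in> ?P (Suc 0 + Suc 0)"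
        using set_power_add[OF V(2), of "inv v" "Suc 0" w "Suc 0"] set_power_one_gen[OF V(2)] V vw by auto
      then have in2: "inv v \<otimes> w \<in> ?P 2" by (simp add: numeral_2_eq_2)
      have "(inv v \<otimes> w) \<otimes> h j = h i"
      proof -
        have "(inv v \<otimes> w) \<otimes> h j = inv v \<otimes> (w \<otimes> h j)" using vG hG[of j] ij by (simp add: m_assoc)
        also have "\<dots> = h i" unfolding eq[symmetric] using vG hG[of i] ij by (simp add: m_assoc[symmetric])
        finally show ?thesis .
      qed
      then have "\<phi> (inv v \<otimes> w) (\<phi> (h j) x) = \<phi> (h i) x"
        using vG hG[of j] ij x by (simp add: act_mult)
      then show False using no[OF in2] h(2)[of i] ij by simp
    qed
    have "i = j \<and> v = w"
      if A: "i \<in> {..D}" "j \<in> {..D}" "v \<in> V" "w \<in> V" "v \<otimes> h i = w \<otimes> h j" for i v j w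
    proof -
      have "i = j" using A neq[of i j v w] neq[of j i w v] by (metis atMost_iff linorder_neqE_nat)
      moreover then have "v = w" using A V hG by (metis atMost_iff r_cancel subsetD)
      ultimately show ?thesis by simp
    qed
    then have inj: "inj_on (\<lambda>(i, v). v \<otimes> h i) ({..D} \<times> V)" unfolding inj_on_def by auto
    have "(\<lambda>(i, v). v \<otimes> h i) ` ({..D} \<times> V) \<subseteq> ?P 11"
      using set_power_add[OF V(2), of _ "Suc 0" _ 10] set_power_one_gen[OF V(2)] h(1) by fastforce
    then have "card ({..D} \<times> V) \<le> card (?P 11)"
      using P(1) card_inj_on_le[OF inj] by blast
    then have "(D + 1) * card V \<le> D * card V" using doubling by (simp add: card_cartesian_product)
    then show False using V by (auto simp: card_gt_0_iff)
  qed
  show ?thesis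
  proof (intro exI[of _ "\<lambda>i. S (N i)"] conjI allI ballI impI)
    show "borel_pred (S (N i))" for i by (rule S1[OF bN])
    fix i x g assume "x \<in> space M" "g \<in> ?P 10" "S (N i) x" "S (N i) (\<phi> g x)"
    then show "\<phi> g x = x" by (rule S3[OF bN])
  qed (rule cover)
qed

end

section \<open>Orthogonal sequences of finite equivalence relations\<close>

context borel_action
begin

lemma borel_pred_cong: "(\<And>x. x \<in> space M \<Longrightarrow> P x = Q x) \<Longrightarrow> borel_pred P = borel_pred Q"
  unfolding borel_pred_def by (metis (mono_tags, lifting) Collect_cong)

text \<open>Borelness is tested along the graph of each group element. For relations bounded by
  group elements this gives Borelness in the product, by \<open>sets_borel_equiv\<close>.\<close>

definition borel_equiv :: "('x \<Rightarrow> 'x \<Rightarrow> bool) \<Rightarrow> bool" where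
  "borel_equiv R \<longleftrightarrow> (\<forall>x y. R x y \<longrightarrow> x \<in> space M \<and> y \<in> space M) \<and>
     (\<forall>x\<in>space M. R x x) \<and> (\<forall>x y. R x y \<longrightarrow> R y x) \<and> (\<forall>x y z. R x y \<longrightarrow> R y z \<longrightarrow> R x z) \<and>
     (\<forall>g\<in>carrier G. borel_pred (\<lambda>x. R x (\<phi> g x)))"

text \<open>For finite A the classes have at most \<open>card A\<close> elements; for A inside a
  subgroup they stay inside its orbits.\<close>

definition bounded_by :: "'g set \<Rightarrow> ('x \<Rightarrow> 'x \<Rightarrow> bool) \<Rightarrow> bool" where
  "bounded_by A R \<longleftrightarrow> (\<forall>x y. R x y \<longrightarrow> (\<exists>g\<in>A. y = \<phi> g x))"

lemma bounded_by_mono: "bounded_by A R \<Longrightarrow> A \<subseteq> B \<Longrightarrow> bounded_by B R"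
  unfolding bounded_by_def by blast

lemma borel_equivD:
  assumes "borel_equiv R"
  shows "R x y \<Longrightarrow> x \<in> space M" "R x y \<Longrightarrow> y \<in> space M" "x \<in> space M \<Longrightarrow> R x x"
    "R x y \<Longrightarrow> R y x" "R x y \<Longrightarrow> R y z \<Longrightarrow> R x z"
    "g \<in> carrier G \<Longrightarrow> borel_pred (\<lambda>x. R x (\<phi> g x))"
  using assms unfolding borel_equiv_def by blast+

text \<open>Substituting \<open>\<phi> g x\<close> for x reduces the pair g, h to the single element
  h g^-1.\<close>

lemma borel_pred_rel:
  assumes R: "borel_equiv R" and gh: "g \<in> carrier G" "h \<in> carrier G"
  shows "borel_pred (\<lambda>x. R (\<phi> g x) (\<phi> h x))"
proof -
  have "borel_pred (\<lambda>x. R (\<phi> g x) (\<phi> (h \<otimes> inv g) (\<phi> g x)))"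
    using borel_pred_act[OF borel_equivD(6)[OF R, of "h \<otimes> inv g"] gh(1)] gh by auto
  moreover have "\<phi> (h \<otimes> inv g) (\<phi> g x) = \<phi> h x" if "x \<in> space M" for x
    using that gh by (simp add: act_mult m_assoc)
  ultimately show ?thesis
    using borel_pred_cong[of "\<lambda>x. R (\<phi> g x) (\<phi> (h \<otimes> inv g) (\<phi> g x))" "\<lambda>x. R (\<phi> g x) (\<phi> h x)"] by simp
qed

section \<open>Pieces around separated markers\<close>

text \<open>The piece of a marker z is the Q-saturation of its translates by B, and near points
  share a piece. So \<open>near Q Z B x x\<close> says that x lies in some piece.\<close>

definition near :: "('x \<Rightarrow> 'x \<Rightarrow> bool) \<Rightarrow> ('x \<Rightarrow> bool) \<Rightarrow> 'g set \<Rightarrow> 'x \<Rightarrow> 'x \<Rightarrow> bool" where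
  "near Q Z B x y \<longleftrightarrow> x \<in> space M \<and> y \<in> space M \<and>
     (\<exists>z\<in>space M. Z z \<and> (\<exists>v\<in>B. Q x (\<phi> v z)) \<and> (\<exists>v\<in>B. Q y (\<phi> v z)))"

end

text \<open>Q-saturation costs one more factor from V, so the points of a piece of radius m \<le> 4
  are within the fifth power of V of the marker, and separation by 10 = 5 + 5 makes the pieces
  disjoint.\<close>

locale marked_equiv = borel_action +
  fixes V :: "'a set" and Q :: "'c \<Rightarrow> 'c \<Rightarrow> bool" and Z :: "'c \<Rightarrow> bool"
  assumes V: "finite V" "V \<subseteq> carrier G" "\<one> \<in> V" "\<And>g. g \<in> V \<Longrightarrow> inv g \<in> V"
    and Q: "borel_equiv Q" "bounded_by V Q"
    and Z: "borel_pred Z"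
      "\<And>x g. x \<in> space M \<Longrightarrow> g \<in> set_power G V 10 \<Longrightarrow> Z x \<Longrightarrow> Z (\<phi> g x) \<Longrightarrow> \<phi> g x = x"
begin

lemma near_marker_translate:
  assumes m: "m \<le> 4" and z: "z \<in> space M" and v: "v \<in> set_power G V m" and x: "Q x (\<phi> v z)"
  shows "\<exists>w\<in>set_power G V 5. z = \<phi> w x \<and> x = \<phi> (inv w) z"
proof -
  have xM: "x \<in> space M" using borel_equivD(1)[OF Q(1) x] .
  have v4: "v \<in> set_power G V 4" "v \<in> carrier G"
    using set_power_mono[OF V(2,3) m] v set_power_closed[OF V(2)] by auto
  obtain a where a: "a \<in> V" "\<phi> v z = \<phi> a x" using Q(2) x unfolding bounded_by_def by blast
  then have aG: "a \<in> carrier G" using V by auto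
  have "inv v \<otimes> a \<in> set_power G V (4 + Suc 0)"
    using set_power_add[OF V(2) set_power_inv[OF V(2,4) v4(1)], of a "Suc 0"] a set_power_one_gen[OF V(2)]
    by simp
  moreover have "z = \<phi> (inv v \<otimes> a) x"
    using a(2) v4 aG xM z by (metis act_inv act_mult inv_closed)
  moreover have "x = \<phi> (inv (inv v \<otimes> a)) z"
    using \<open>z = \<phi> (inv v \<otimes> a) x\<close> v4 aG xM by (metis act_inv inv_closed m_closed)
  ultimately show ?thesis by auto
qed

lemma near_marker_unique:
  assumes m: "m \<le> 4" and z: "z \<in> space M" "z' \<in> space M" "Z z" "Z z'"
    and v: "v \<in> set_power G V m" "v' \<in> set_power G V m"
    and x: "Q x (\<phi> v z)" "Q x (\<phi> v' z')"
  shows "z = z'"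
proof -
  obtain w w' where w: "w \<in> set_power G V 5" "w' \<in> set_power G V 5" "x = \<phi> (inv w) z" "z' = \<phi> w' x"
    using near_marker_translate[OF m z(1) v(1) x(1)] near_marker_translate[OF m z(2) v(2) x(2)] by blast
  have wG: "w \<in> carrier G" "w' \<in> carrier G" using w set_power_closed[OF V(2)] by auto
  have "w' \<otimes> inv w \<in> set_power G V (5 + 5)"
    using set_power_add[OF V(2) w(2) set_power_inv[OF V(2,4) w(1)]] by simp
  moreover have "z' = \<phi> (w' \<otimes> inv w) z" using w wG z by (simp add: act_mult)
  ultimately show ?thesis using Z(2)[of z "w' \<otimes> inv w"] z by simp
qed

lemma near_sym: "near Q Z B x y \<Longrightarrow> near Q Z B y x"
  unfolding near_def by blast

text \<open>Both pairs share y, whose marker is unique.\<close>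

lemma near_trans:
  assumes m: "m \<le> 4" and "near Q Z (set_power G V m) x y" "near Q Z (set_power G V m) y u"
  shows "near Q Z (set_power G V m) x u"
  using assms(2,3) near_marker_unique[OF m] unfolding near_def by metis

lemma near_saturated:
  assumes n: "near Q Z B x y" and y: "Q y y'"
  shows "near Q Z B x y'"
proof -
  obtain z v v' where z: "z \<in> space M" "Z z" "v \<in> B" "Q x (\<phi> v z)" "v' \<in> B" "Q y (\<phi> v' z)"
    using n unfolding near_def by blast
  have "Q y' (\<phi> v' z)" by (rule borel_equivD(5)[OF Q(1) borel_equivD(4)[OF Q(1) y] z(6)])
  moreover have "x \<in> space M" "y' \<in> space M"
    using borel_equivD(1)[OF Q(1) z(4)] borel_equivD(2)[OF Q(1) y] .
  ultimately show ?thesis unfolding near_def using z by blast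
qed

lemma bounded_by_near:
  assumes m: "m \<le> 4"
  shows "bounded_by (set_power G V 10) (near Q Z (set_power G V m))"
  unfolding bounded_by_def
proof (intro allI impI)
  fix x y assume "near Q Z (set_power G V m) x y"
  then obtain z v v' where z: "z \<in> space M" "x \<in> space M" "y \<in> space M"
    and v: "v \<in> set_power G V m" "Q x (\<phi> v z)" "v' \<in> set_power G V m" "Q y (\<phi> v' z)"
    unfolding near_def by blast
  obtain w w' where w: "w \<in> set_power G V 5" "w' \<in> set_power G V 5" "z = \<phi> w x" "y = \<phi> (inv w') z"
    using near_marker_translate[OF m z(1) v(1,2)] near_marker_translate[OF m z(1) v(3,4)] by blast
  have wG: "w \<in> carrier G" "w' \<in> carrier G" using w set_power_closed[OF V(2)] by auto
  have "inv w' \<otimes> w \<in> set_power G V (5 + 5)"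
    using set_power_add[OF V(2) set_power_inv[OF V(2,4) w(2)] w(1)] by simp
  moreover have "y = \<phi> (inv w' \<otimes> w) x" using w wG z by (simp add: act_mult)
  ultimately show "\<exists>g\<in>set_power G V 10. y = \<phi> g x" by auto
qed

text \<open>The marker z ranges over the whole space, but it is a translate of x, so a quantifier
  over the countable group replaces it.\<close>

lemma borel_pred_near:
  assumes m: "m \<le> 4" and h: "h \<in> carrier G"
  shows "borel_pred (\<lambda>x. near Q Z (set_power G V m) x (\<phi> h x))"
proof -
  let ?B = "set_power G V m"
  have B: "?B \<subseteq> carrier G" "countable ?B"
    using set_power_closed[OF V(2)] finite_set_power[OF V(1)] by (auto intro: countable_finite)
  have "near Q Z ?B x (\<phi> h x) \<longleftrightarrow> (\<exists>g\<in>carrier G. Z (\<phi> g x) \<and>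
      (\<exists>v\<in>?B. Q (\<phi> \<one> x) (\<phi> (v \<otimes> g) x)) \<and> (\<exists>v\<in>?B. Q (\<phi> h x) (\<phi> (v \<otimes> g) x)))"
    (is "_ \<longleftrightarrow> ?r x") if x: "x \<in> space M" for x
  proof
    assume "near Q Z ?B x (\<phi> h x)"
    then obtain z v v' where z: "z \<in> space M" "Z z"
      and v: "v \<in> ?B" "Q x (\<phi> v z)" "v' \<in> ?B" "Q (\<phi> h x) (\<phi> v' z)"
      unfolding near_def by blast
    obtain w where w: "w \<in> set_power G V 5" "z = \<phi> w x"
      using near_marker_translate[OF m z(1) v(1,2)] by blast
    have wG: "w \<in> carrier G" using w set_power_closed[OF V(2)] by auto
    have "\<phi> (u \<otimes> w) x = \<phi> u z" if "u \<in> ?B" for u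
      using that B(1) wG w x by (auto simp: act_mult)
    then show "?r x" using z v w wG x by (intro bexI[of _ w]) auto
  next
    assume "?r x"
    then obtain g v v' where "g \<in> carrier G" "Z (\<phi> g x)" "v \<in> ?B" "v' \<in> ?B"
      "Q x (\<phi> (v \<otimes> g) x)" "Q (\<phi> h x) (\<phi> (v' \<otimes> g) x)" using x by auto
    moreover have "\<phi> (u \<otimes> g) x = \<phi> u (\<phi> g x)" if "u \<in> ?B" "g \<in> carrier G" for u g
      using that B(1) x by (auto simp: act_mult)
    ultimately show "near Q Z ?B x (\<phi> h x)" unfolding near_def using x h
      by (intro conjI bexI[of _ "\<phi> g x"]) auto
  qed
  moreover have "borel_pred ?r"
  proof (intro borel_pred_Bex countable_group borel_pred_conj B(2))
    fix g assume g: "g \<in> carrier G"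
    show "borel_pred (\<lambda>x. Z (\<phi> g x))" by (rule borel_pred_act[OF Z(1) g])
    fix v assume v: "v \<in> ?B"
    show "borel_pred (\<lambda>x. Q (\<phi> \<one> x) (\<phi> (v \<otimes> g) x))" "borel_pred (\<lambda>x. Q (\<phi> h x) (\<phi> (v \<otimes> g) x))"
      using v g h B(1) by (auto intro!: borel_pred_rel Q)
  qed
  ultimately show ?thesis using borel_pred_cong[of "\<lambda>x. near Q Z ?B x (\<phi> h x)" ?r] by simp
qed

text \<open>Pieces are Q-saturated and disjoint, so merging each piece into one class is transitive
  at once.\<close>

lemma borel_equiv_merge:
  "borel_equiv (\<lambda>x y. Q x y \<or> near Q Z (set_power G V 4) x y)"
  unfolding borel_equiv_def
proof (intro conjI allI ballI impI)
  fix x y z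
  let ?R = "\<lambda>x y. Q x y \<or> near Q Z (set_power G V 4) x y"
  have near_left: "near Q Z B u w" if "Q u v" "near Q Z B v w" for u v w B
    using near_sym[OF near_saturated[OF near_sym[OF that(2)] borel_equivD(4)[OF Q(1) that(1)]]] .
  show "?R x z" if R: "?R x y" "?R y z"
  proof (cases "Q x y")
    case True
    then show ?thesis using R(2) near_left[OF True] borel_equivD(5)[OF Q(1) True] by metis
  next
    case False
    then have "near Q Z (set_power G V 4) x y" using R(1) by simp
    then show ?thesis using R(2) near_saturated near_trans[of 4] by (metis order_refl)
  qed
  show "borel_pred (\<lambda>x. ?R x (\<phi> g x))" if "g \<in> carrier G" for g
    using that by (intro borel_pred_disj borel_equivD(6)[OF Q(1)] borel_pred_near) auto
  show "?R y x" if "?R x y" using that borel_equivD(4)[OF Q(1), of x y] near_sym by blast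
  show "x \<in> space M" "y \<in> space M" if "?R x y"
    using that borel_equivD(1,2)[OF Q(1), of x y] unfolding near_def by blast+
  show "?R x x" if "x \<in> space M" using borel_equivD(3)[OF Q(1) that] by blast
qed

text \<open>This fixes the larger radius: 4 is one factor for the step along V, one for Q, and two
  for the smaller radius.\<close>

lemma near_enlarge:
  assumes xy: "near Q Z (set_power G V 2) x x" "y = \<phi> g x \<or> x = \<phi> g y" "y \<in> space M" "g \<in> V"
  shows "near Q Z (set_power G V 4) x y"
proof -
  obtain z v where z: "z \<in> space M" "Z z" "x \<in> space M" "v \<in> set_power G V 2" "Q x (\<phi> v z)"
    using xy(1) unfolding near_def by blast
  have gG: "g \<in> carrier G" using xy V by auto
  have "\<exists>h\<in>V. y = \<phi> h x"
    using xy(2,4) act_inv[OF gG xy(3)] V(4)[OF xy(4)] by metis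
  then obtain h where h: "h \<in> V" "y = \<phi> h x" by auto
  obtain a where a: "a \<in> V" "x = \<phi> a (\<phi> v z)"
    using Q(2) borel_equivD(4)[OF Q(1) z(5)] unfolding bounded_by_def by blast
  have G: "h \<in> carrier G" "a \<in> carrier G" "v \<in> carrier G"
    using h a z V set_power_closed[OF V(2)] by auto
  have one_step: "h \<in> set_power G V (Suc 0)" "a \<in> set_power G V (Suc 0)"
    using h(1) a(1) unfolding set_power_one_gen[OF V(2)] by auto
  have "h \<otimes> (a \<otimes> v) \<in> set_power G V (Suc 0 + (Suc 0 + 2))"
    by (intro set_power_add[OF V(2)] one_step z(4))
  moreover have "Suc 0 + (Suc 0 + 2) = (4 :: nat)" by simp
  ultimately have "h \<otimes> (a \<otimes> v) \<in> set_power G V 4" by (simp only:)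
  moreover have "y = \<phi> (h \<otimes> (a \<otimes> v)) z"
    using h(2) a(2) G z by (simp add: act_mult)
  moreover have "v \<in> set_power G V 4" using set_power_mono[OF V(2,3), of 2 4] z by auto
  ultimately show ?thesis
    unfolding near_def using z xy(3) borel_equivD(3)[OF Q(1) xy(3)] by metis
qed

end

section \<open>One round of cutting and its iteration\<close>

context borel_action
begin

text \<open>Type \<open>i\<close> cuts \<open>X\<close> only along boundaries of
  \<open>Q i\<close>-saturated pieces, and \<open>Q' i\<close> glues everything close to these boundaries, so that
  no later stage can cut the same pair again by a piece of type \<open>i\<close>.\<close>

lemma orthogonal_stage:
  assumes H: "subgroup H G" and tame: "tame G H D"
    and Q: "\<And>i. i < D \<Longrightarrow> borel_equiv (Q i)" "\<And>i. i < D \<Longrightarrow> bounded_by A (Q i)"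
    and A: "finite A" "A \<subseteq> H" and s: "finite s" "s \<subseteq> H"
  shows "\<exists>R Q' B. borel_equiv R \<and> finite B \<and> B \<subseteq> H \<and> bounded_by B R \<and>
    (\<forall>i<D. borel_equiv (Q' i) \<and> bounded_by B (Q' i) \<and> (\<forall>x y. Q i x y \<longrightarrow> Q' i x y)) \<and>
    (\<forall>x\<in>space M. \<forall>g\<in>s. \<not> R x (\<phi> g x) \<longrightarrow> (\<exists>i<D. \<not> Q i x (\<phi> g x) \<and> Q' i x (\<phi> g x)))"
proof -
  have HG: "H \<subseteq> carrier G" using subgroup.subset[OF H] .
  \<comment> \<open>As V contains A, every \<open>Q i\<close> is bounded by V; as it contains s, a
    step along s is a step along V.\<close>
  obtain V where V: "finite V" "A \<union> s \<subseteq> V" "V \<subseteq> H" "\<one> \<in> V" "\<forall>v\<in>V. inv v \<in> V"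
    "card (set_power G V 11) \<le> D * card V"
    using tame[unfolded tame_def, rule_format, of "A \<union> s"] A s by auto
  have VG: "V \<subseteq> carrier G" using V(3) HG by auto
  have Vinv: "inv v \<in> V" if "v \<in> V" for v using V(5) that by blast
  let ?P = "set_power G V"
  obtain Z where Z: "\<And>i. borel_pred (Z i)"
    "\<And>i x g. x \<in> space M \<Longrightarrow> g \<in> ?P 10 \<Longrightarrow> Z i x \<Longrightarrow> Z i (\<phi> g x) \<Longrightarrow> \<phi> g x = x"
    "\<And>x. x \<in> space M \<Longrightarrow> \<exists>i<D. \<exists>g\<in>?P 2. Z i (\<phi> g x)"
    using separated_markers[OF V(1) VG V(4) Vinv V(6)] by blast
  have S: "marked_equiv G M \<phi> V (Q i) (Z i)" if "i < D" for i
    by unfold_locales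
      (use V(1,4) VG Vinv Q(1)[OF that] bounded_by_mono[OF Q(2)[OF that]] V(2) Z(1,2) in auto)
  define N where "N i = near (Q i) (Z i) (?P 2)" for i
  have N_sym: "N i y x" if "N i x y" for i x y
    using that unfolding N_def near_def by blast
  have N_trans: "N i x z" if "i < D" "N i x y" "N i y z" for i x y z
    using that(2,3) unfolding N_def by (rule marked_equiv.near_trans[OF S[OF that(1)], rotated]) simp
  have N_sat: "N i x y'" if "i < D" "N i x y" "Q i y y'" for i x y y'
    using that(2,3) unfolding N_def by (rule marked_equiv.near_saturated[OF S[OF that(1)]])
  have N_borel: "borel_pred (\<lambda>x. N i x (\<phi> h x))" if "i < D" "h \<in> carrier G" for i h
    unfolding N_def by (rule marked_equiv.borel_pred_near[OF S[OF that(1)] _ that(2)]) simp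
  have N_borel_diag: "borel_pred (\<lambda>x. N i x x)" if "i < D" for i
    using N_borel[OF that, of \<one>] borel_pred_cong[of "\<lambda>x. N i x (\<phi> \<one> x)" "\<lambda>x. N i x x"] by auto
  have N_cover: "\<exists>i<D. N i x x" if x: "x \<in> space M" for x
  proof -
    obtain i g where ig: "i < D" "g \<in> ?P 2" "Z i (\<phi> g x)" using Z(3)[OF x] by blast
    have gG: "g \<in> carrier G" using ig(2) set_power_closed[OF VG] by auto
    have "Q i x (\<phi> (inv g) (\<phi> g x))"
      using borel_equivD(3)[OF Q(1)[OF ig(1)] x] act_inv[OF gG x] by simp
    moreover have "inv g \<in> ?P 2" by (rule set_power_inv[OF VG Vinv ig(2)])
    ultimately have "N i x x"
      unfolding N_def near_def using x ig(3) gG by (intro conjI bexI[of _ "\<phi> g x"]) auto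
    then show ?thesis using ig(1) by blast
  qed
  \<comment> \<open>Each point belongs to the piece of the least type that covers it; R compares
    these pieces.\<close>
  define R where "R x y \<longleftrightarrow> x \<in> space M \<and> y \<in> space M \<and>
    (\<exists>i<D. N i x y \<and> (\<forall>j<i. \<not> N j x x \<and> \<not> N j y y))" for x y
  have least: "\<exists>i<D. (N i x x \<or> N i y y) \<and> (\<forall>j<i. \<not> N j x x \<and> \<not> N j y y)"
    if "x \<in> space M" for x y
  proof -
    obtain i where "i < D" "N i x x" using N_cover[OF \<open>x \<in> space M\<close>] by blast
    then have "\<exists>i. i < D \<and> (N i x x \<or> N i y y)" by blast
    from exists_least_iff[THEN iffD1, OF this] show ?thesis by (meson order.strict_trans)
  qed
  have R_refl: "R x x" if "x \<in> space M" for x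
    using least[OF that, of x] that unfolding R_def by auto
  have "borel_equiv R"
    unfolding borel_equiv_def
  proof (intro conjI allI ballI impI)
    fix x y z
    show "x \<in> space M" "y \<in> space M" if "R x y" using that unfolding R_def by auto
    show "R y x" if "R x y" using that N_sym unfolding R_def by blast
    show "R x z" if R: "R x y" "R y z"
    proof -
      obtain i where i: "i < D" "N i x y" "\<And>j. j < i \<Longrightarrow> \<not> N j x x \<and> \<not> N j y y"
        using R(1) unfolding R_def by blast
      obtain j where j: "j < D" "N j y z" "\<And>k. k < j \<Longrightarrow> \<not> N k y y \<and> \<not> N k z z"
        using R(2) unfolding R_def by blast
      have "N i y y" "N j y y"
        using N_trans[OF i(1) N_sym[OF i(2)] i(2)] N_trans[OF j(1) j(2) N_sym[OF j(2)]] by auto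
      then have "i = j" using i(3) j(3) by (meson linorder_neqE_nat)
      then show ?thesis using N_trans[OF i(1) i(2)] i j R unfolding R_def by blast
    qed
    show "R x x" if "x \<in> space M" using R_refl[OF that] .
    fix h assume h: "h \<in> carrier G"
    have "borel_pred (\<lambda>x. \<exists>i\<in>{..<D}. N i x (\<phi> h x) \<and> (\<forall>j\<in>{..<i}. \<not> N j x x \<and> \<not> N j (\<phi> h x) (\<phi> h x)))"
      by (intro borel_pred_Bex borel_pred_Ball borel_pred_conj borel_pred_not N_borel N_borel_diag
          borel_pred_act[of "\<lambda>x. N _ x x"] h) auto
    moreover have "R x (\<phi> h x) \<longleftrightarrow> (\<exists>i\<in>{..<D}. N i x (\<phi> h x) \<and>
        (\<forall>j\<in>{..<i}. \<not> N j x x \<and> \<not> N j (\<phi> h x) (\<phi> h x)))" if "x \<in> space M" for x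
      unfolding R_def using that h by auto
    ultimately show "borel_pred (\<lambda>x. R x (\<phi> h x))"
      using borel_pred_cong[of "\<lambda>x. R x (\<phi> h x)"
        "\<lambda>x. \<exists>i\<in>{..<D}. N i x (\<phi> h x) \<and> (\<forall>j\<in>{..<i}. \<not> N j x x \<and> \<not> N j (\<phi> h x) (\<phi> h x))"] by simp
  qed
  moreover have "bounded_by (?P 10) R"
    unfolding bounded_by_def
  proof (intro allI impI)
    fix x y assume "R x y"
    then obtain i where "i < D" "N i x y" unfolding R_def by blast
    then show "\<exists>g\<in>?P 10. y = \<phi> g x"
      using marked_equiv.bounded_by_near[OF S, of i 2] unfolding N_def bounded_by_def by auto
  qed
  moreover define Q' where "Q' i x y \<longleftrightarrow> Q i x y \<or> near (Q i) (Z i) (?P 4) x y" for i x y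
  have "borel_equiv (Q' i) \<and> bounded_by (?P 10) (Q' i) \<and> (\<forall>x y. Q i x y \<longrightarrow> Q' i x y)" if i: "i < D" for i
  proof (intro conjI)
    show "borel_equiv (Q' i)" unfolding Q'_def by (rule marked_equiv.borel_equiv_merge[OF S[OF i]])
    have "A \<subseteq> ?P 10"
      using set_power_mono[OF VG V(4), of "Suc 0" 10] set_power_one_gen[OF VG] V(2) by auto
    then have "bounded_by (?P 10) (Q i)" using bounded_by_mono[OF Q(2)[OF i]] by blast
    moreover have "bounded_by (?P 10) (near (Q i) (Z i) (?P 4))"
      by (rule marked_equiv.bounded_by_near[OF S[OF i]]) simp
    ultimately show "bounded_by (?P 10) (Q' i)" unfolding Q'_def bounded_by_def by blast
  qed (simp add: Q'_def)
  moreover have "\<exists>i<D. \<not> Q i x (\<phi> g x) \<and> Q' i x (\<phi> g x)"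
    if x: "x \<in> space M" and g: "g \<in> s" and nR: "\<not> R x (\<phi> g x)" for x g
  proof -
    define y where "y = \<phi> g x"
    have gV: "g \<in> V" using g V(2) by auto
    have y: "y \<in> space M" unfolding y_def using gV VG x by auto
    obtain i where i: "i < D" "N i x x \<or> N i y y" "\<And>j. j < i \<Longrightarrow> \<not> N j x x \<and> \<not> N j y y"
      using least[OF x] by blast
    have nN: "\<not> N i x y" using nR i x y unfolding R_def y_def[symmetric] by blast
    \<comment> \<open>Pieces of type i are saturated for \<open>Q i\<close>, so they cannot cut a
      pair in \<open>Q i\<close>.\<close>
    have nQ: "\<not> Q i x y"
    proof
      assume Q_xy: "Q i x y"
      show False using i(2)
      proof
        assume "N i x x" then show False using N_sat[OF i(1) _ Q_xy] nN by blast
      next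
        assume "N i y y"
        then have "N i y x" using N_sat[OF i(1) _ borel_equivD(4)[OF Q(1)[OF i(1)] Q_xy]] by blast
        then show False using N_sym nN by blast
      qed
    qed
    \<comment> \<open>One of the points lies in a piece of radius 2, and the other is one step of V
      away.\<close>
    have "near (Q i) (Z i) (?P 4) x y" using i(2)
    proof
      assume "N i x x"
      then show ?thesis
        using marked_equiv.near_enlarge[OF S[OF i(1)], of x y g] y gV unfolding N_def y_def by auto
    next
      assume "N i y y"
      then have "near (Q i) (Z i) (?P 4) y x"
        using marked_equiv.near_enlarge[OF S[OF i(1)], of y x g] x gV unfolding N_def y_def by auto
      then show ?thesis unfolding near_def by blast
    qed
    then show ?thesis using i(1) nQ unfolding Q'_def y_def by blast
  qed
  ultimately show ?thesis
    using finite_set_power[OF V(1), of 10] set_power_subset_subgroup[OF H V(3), of 10]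
    by (intro exI[of _ R] exI[of _ Q'] exI[of _ "?P 10"]) blast
qed

text \<open>A cut of a pair in round k is charged to a type that glues the pair after round k but
  not before. Gluing is permanent, so distinct rounds charge distinct types, and a type i with the
  pair in \<open>P i\<close> is never charged.\<close>

lemma orthogonal_sequence:
  assumes H: "subgroup H G" and tame: "tame G H D"
    and P: "\<And>i. i < D \<Longrightarrow> borel_equiv (P i)" "\<And>i. i < D \<Longrightarrow> bounded_by A (P i)"
    and A: "finite A" "A \<subseteq> H" and s: "finite s" "s \<subseteq> H"
  shows "\<exists>R :: nat \<Rightarrow> 'x \<Rightarrow> 'x \<Rightarrow> bool.
    (\<forall>k. borel_equiv (R k) \<and> (\<exists>B. finite B \<and> B \<subseteq> H \<and> bounded_by B (R k))) \<and>
    (\<forall>x\<in>space M. \<forall>g\<in>s. finite {k. \<not> R k x (\<phi> g x)} \<and>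
      card {k. \<not> R k x (\<phi> g x)} \<le> card {i. i < D \<and> \<not> P i x (\<phi> g x)})"
proof -
  \<comment> \<open>The finite set B may grow from round to round; within a round it serves all
    types.\<close>
  define good where "good Q \<longleftrightarrow> (\<exists>B. finite B \<and> B \<subseteq> H \<and> (\<forall>i<D. borel_equiv (Q i) \<and> bounded_by B (Q i)))"
    for Q :: "nat \<Rightarrow> 'x \<Rightarrow> 'x \<Rightarrow> bool"
  define cut where "cut Q Q' R \<longleftrightarrow> borel_equiv R \<and> (\<exists>B. finite B \<and> B \<subseteq> H \<and> bounded_by B R) \<and>
    (\<forall>i<D. \<forall>x y. Q i x y \<longrightarrow> Q' i x y) \<and>
    (\<forall>x\<in>space M. \<forall>g\<in>s. \<not> R x (\<phi> g x) \<longrightarrow> (\<exists>i<D. \<not> Q i x (\<phi> g x) \<and> Q' i x (\<phi> g x)))"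
    for Q Q' :: "nat \<Rightarrow> 'x \<Rightarrow> 'x \<Rightarrow> bool" and R
  have step: "\<exists>Q'. good Q' \<and> (\<exists>R. cut Q Q' R)" if "good Q" for Q
  proof -
    from that obtain B where B: "finite B" "B \<subseteq> H"
      "\<forall>i<D. borel_equiv (Q i) \<and> bounded_by B (Q i)"
      unfolding good_def by (elim exE conjE)
    have "\<exists>R Q' B. borel_equiv R \<and> finite B \<and> B \<subseteq> H \<and> bounded_by B R \<and>
      (\<forall>i<D. borel_equiv (Q' i) \<and> bounded_by B (Q' i) \<and> (\<forall>x y. Q i x y \<longrightarrow> Q' i x y)) \<and>
      (\<forall>x\<in>space M. \<forall>g\<in>s. \<not> R x (\<phi> g x) \<longrightarrow> (\<exists>i<D. \<not> Q i x (\<phi> g x) \<and> Q' i x (\<phi> g x)))"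
      by (rule orthogonal_stage[OF H tame _ _ B(1,2) s]) (simp_all add: B(3))
    then obtain R Q' B' where R: "borel_equiv R" "finite B'" "B' \<subseteq> H" "bounded_by B' R"
      and Q': "\<forall>i<D. borel_equiv (Q' i) \<and> bounded_by B' (Q' i) \<and> (\<forall>x y. Q i x y \<longrightarrow> Q' i x y)"
      and cutR: "\<forall>x\<in>space M. \<forall>g\<in>s. \<not> R x (\<phi> g x) \<longrightarrow>
        (\<exists>i<D. \<not> Q i x (\<phi> g x) \<and> Q' i x (\<phi> g x))"
      by (elim exE conjE)
    have "good Q'" unfolding good_def using R(2,3) Q' by (intro exI[of _ B']) simp
    moreover have "cut Q Q' R" unfolding cut_def
      by (intro conjI exI[of _ B'] R cutR) (use Q' in simp)
    ultimately show ?thesis by blast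
  qed
  \<comment> \<open>The clause on k = 0 pins the start of the dependent choice to P.\<close>
  have "\<exists>Q. \<forall>k. (good (Q k) \<and> (k = 0 \<longrightarrow> Q k = P)) \<and> (\<exists>R. cut (Q k) (Q (Suc k)) R)"
  proof (rule dependent_nat_choice)
    show "\<exists>Q. good Q \<and> (0 = (0 :: nat) \<longrightarrow> Q = P)" unfolding good_def using P A
      by (intro exI[of _ P] conjI exI[of _ A]) auto
    show "\<exists>Q'. (good Q' \<and> (Suc k = 0 \<longrightarrow> Q' = P)) \<and> (\<exists>R. cut Q Q' R)"
      if "good Q \<and> (k = 0 \<longrightarrow> Q = P)" for Q k
      using step that by auto
  qed
  then obtain Q where Q: "Q 0 = P" "\<And>k. \<exists>R. cut (Q k) (Q (Suc k)) R" by blast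
  then obtain R where R: "\<And>k. cut (Q k) (Q (Suc k)) (R k)" by metis
  have mono: "Q l i x y" if "Q k i x y" "k \<le> l" "i < D" for k l i x y
    using that(2,1)
  proof (induction l rule: dec_induct)
    case (step l)
    then show ?case using R[of l] that(3) unfolding cut_def by blast
  qed
  have "finite {k. \<not> R k x (\<phi> g x)} \<and> card {k. \<not> R k x (\<phi> g x)} \<le> card {i. i < D \<and> \<not> P i x (\<phi> g x)}"
    if xg: "x \<in> space M" "g \<in> s" for x g
  proof -
    let ?K = "{k. \<not> R k x (\<phi> g x)}" and ?I = "{i. i < D \<and> \<not> P i x (\<phi> g x)}"
    have "\<forall>k\<in>?K. \<exists>i. i < D \<and> \<not> Q k i x (\<phi> g x) \<and> Q (Suc k) i x (\<phi> g x)"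
      using R xg unfolding cut_def by blast
    from bchoice[OF this] obtain c
      where c: "\<And>k. k \<in> ?K \<Longrightarrow> c k < D \<and> \<not> Q k (c k) x (\<phi> g x) \<and> Q (Suc k) (c k) x (\<phi> g x)" by blast
    have no: "c k \<noteq> c l" if "k \<in> ?K" "l \<in> ?K" "k < l" for k l
      using c[OF that(1)] c[OF that(2)] mono[of "Suc k" "c k" x "\<phi> g x" l] that(3) by auto
    have inj: "inj_on c ?K"
    proof (rule inj_onI)
      fix k l assume "k \<in> ?K" "l \<in> ?K" "c k = c l"
      then show "k = l" using no[of k l] no[of l k] by (cases k l rule: linorder_cases) auto
    qed
    have img: "c ` ?K \<subseteq> ?I"
    proof
      fix i assume "i \<in> c ` ?K"
      then obtain k where k: "k \<in> ?K" "i = c k" by blast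
      then have "\<not> P i x (\<phi> g x)" using c[OF k(1)] mono[of 0 i x "\<phi> g x" k] Q(1) by auto
      then show "i \<in> ?I" using c[OF k(1)] k(2) by simp
    qed
    have fin: "finite ?I" by simp
    show ?thesis by (rule conjI[OF inj_on_finite[OF inj img fin] card_inj_on_le[OF inj img fin]])
  qed
  moreover have "borel_equiv (R k) \<and> (\<exists>B. finite B \<and> B \<subseteq> H \<and> bounded_by B (R k))" for k
    using R[of k] unfolding cut_def by (elim conjE) (rule conjI)
  ultimately show ?thesis by (intro exI[of _ R]) simp
qed

end

section \<open>Increasing unions\<close>

context borel_action
begin

text \<open>R is the union over g of the graph of \<open>\<phi> g\<close> restricted to the Borel
  set \<open>C g\<close>, and the graph is a countable intersection because the \<open>b n\<close>
  separate points.\<close>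

lemma sets_borel_equiv:
  assumes R: "borel_equiv R" and B: "bounded_by B R" "B \<subseteq> carrier G"
  shows "{(x, y). R x y} \<in> sets (M \<Otimes>\<^sub>M M)"
proof -
  obtain b :: "nat \<Rightarrow> 'x set" where b: "\<And>n. b n \<in> sets M"
    "\<And>x F. x \<in> space M \<Longrightarrow> finite F \<Longrightarrow> F \<subseteq> space M \<Longrightarrow> x \<notin> F \<Longrightarrow> \<exists>n. x \<in> b n \<and> b n \<inter> F = {}"
    using obtain_separating_sequence by blast
  define C where "C g = {x \<in> space M. R x (\<phi> g x)}" for g
  have C: "C g \<in> sets M" if "g \<in> carrier G" for g
    using borel_equivD(6)[OF R that] unfolding borel_pred_def C_def .
  have pre: "\<phi> g -` b n \<inter> space M \<in> sets M" if "g \<in> carrier G" for g n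
    by (rule measurable_sets[OF measurable_action[OF that] b(1)])
  \<comment> \<open>The pairs for which \<open>\<phi> g x\<close> in \<open>b n\<close> forces y
    into \<open>b n\<close>, written as a union of two rectangles.\<close>
  define E where "E g n = (space M - (\<phi> g -` b n \<inter> space M)) \<times> space M \<union> space M \<times> b n" for g n
  have E: "E g n \<in> sets (M \<Otimes>\<^sub>M M)" if "g \<in> carrier G" for g n
    unfolding E_def by (intro sets.Un pair_measureI sets.compl_sets pre[OF that] b(1) sets.top)
  have in_E: "\<phi> g x = y" if xy: "x \<in> space M" "y \<in> space M" and g: "g \<in> carrier G"
    and n: "\<And>n. (x, y) \<in> E g n" for x y g
  proof (rule ccontr)
    assume "\<phi> g x \<noteq> y"
    then obtain n where "\<phi> g x \<in> b n" "b n \<inter> {y} = {}"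
      using b(2)[of "\<phi> g x" "{y}"] xy g by auto
    then show False using n[of n] xy unfolding E_def by auto
  qed
  have "{(x, y). R x y} = (\<Union>g\<in>carrier G. (C g \<times> space M) \<inter> (\<Inter>n. E g n))"
  proof (intro Set.set_eqI iffI)
    fix p assume "p \<in> {(x, y). R x y}"
    then obtain x y where p: "p = (x, y)" "R x y" by auto
    then obtain g where g: "g \<in> B" "y = \<phi> g x" using B(1) unfolding bounded_by_def by blast
    have xM: "x \<in> space M" "y \<in> space M" using borel_equivD(1,2)[OF R p(2)] .
    then have "p \<in> (C g \<times> space M) \<inter> (\<Inter>n. E g n)"
      using p g unfolding C_def E_def by auto
    then show "p \<in> (\<Union>g\<in>carrier G. (C g \<times> space M) \<inter> (\<Inter>n. E g n))" using g B(2) by blast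
  next
    fix p assume "p \<in> (\<Union>g\<in>carrier G. (C g \<times> space M) \<inter> (\<Inter>n. E g n))"
    then obtain g x y where p: "g \<in> carrier G" "p = (x, y)" "x \<in> C g" "y \<in> space M" "\<And>n. (x, y) \<in> E g n"
      by (cases p) auto
    then have "\<phi> g x = y" using in_E[of x y g] unfolding C_def by auto
    then show "p \<in> {(x, y). R x y}" using p unfolding C_def by auto
  qed
  moreover have "\<dots> \<in> sets (M \<Otimes>\<^sub>M M)"
    using C E countable_group
    by (intro sets.countable_UN' sets.Int pair_measureI sets.countable_INT') auto
  ultimately show ?thesis by simp
qed

lemma borel_equiv_Id: "borel_equiv (\<lambda>x y. x \<in> space M \<and> x = y)"
  unfolding borel_equiv_def
proof (intro conjI allI ballI impI)
  fix g assume g: "g \<in> carrier G"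
  show "borel_pred (\<lambda>x. x \<in> space M \<and> x = \<phi> g x)"
    using borel_pred_fixed[OF g] borel_pred_cong[of "\<lambda>x. x \<in> space M \<and> x = \<phi> g x" "\<lambda>x. \<phi> g x = x"]
    by (metis (no_types, lifting))
qed auto

lemma borel_equiv_tail_Inter:
  fixes R :: "nat \<Rightarrow> 'x \<Rightarrow> 'x \<Rightarrow> bool"
  assumes "\<And>n. borel_equiv (R n)"
  shows "borel_equiv (\<lambda>x y. \<forall>n. R (N + n) x y)"
  unfolding borel_equiv_def
proof (intro conjI allI ballI impI)
  fix x y z n
  show "x \<in> space M" "y \<in> space M" if "\<forall>n. R (N + n) x y"
    using borel_equivD(1,2)[OF assms] that by blast+
  show "R (N + n) x x" if "x \<in> space M" using borel_equivD(3)[OF assms that] .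
  show "R (N + n) y x" if "\<forall>n. R (N + n) x y" using borel_equivD(4)[OF assms] that by blast
  show "R (N + n) x z" if "\<forall>n. R (N + n) x y" "\<forall>n. R (N + n) y z"
    using borel_equivD(5)[OF assms, of "N + n" x y z] that by blast
next
  fix g assume "g \<in> carrier G"
  then show "borel_pred (\<lambda>x. \<forall>n. R (N + n) x (\<phi> g x))"
    by (intro borel_pred_All borel_equivD(6)[OF assms])
qed

text \<open>The intersections of the tails of the sequence increase, each is contained in a bounded
  relation, and by \<open>ev\<close> they exhaust the orbit relation.\<close>

lemma hyperfinite_liminf:
  fixes R :: "nat \<Rightarrow> 'x \<Rightarrow> 'x \<Rightarrow> bool"
  assumes R: "\<And>n. borel_equiv (R n)" "\<And>n. finite (B n)" "\<And>n. B n \<subseteq> carrier G"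
      "\<And>n. bounded_by (B n) (R n)"
    and ev: "\<And>x g. x \<in> space M \<Longrightarrow> g \<in> carrier G \<Longrightarrow> \<exists>N. \<forall>n\<ge>N. R n x (\<phi> g x)"
  shows "hyperfinite M (orbit_equivalence G M \<phi>)"
proof -
  define S where "S N x y \<longleftrightarrow> (\<forall>n. R (N + n) x y)" for N x y
  have S: "borel_equiv (S N)" for N
    unfolding S_def by (rule borel_equiv_tail_Inter[OF R(1)])
  have S_sub: "R N x y" if "S N x y" for N x y
    using that unfolding S_def by (metis add.right_neutral)
  have bS: "bounded_by (B N) (S N)" for N
    using R(4)[of N] S_sub unfolding bounded_by_def by blast
  define F where "F N = {(x, y). S N x y}" for N
  have "finite_borel_equivalence M (F N)" for N
    unfolding finite_borel_equivalence_def
  proof (intro conjI ballI)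
    show "F N \<in> sets (M \<Otimes>\<^sub>M M)" unfolding F_def by (rule sets_borel_equiv[OF S bS R(3)])
    show "equiv (space M) (F N)"
    proof (rule equivI)
      show "F N \<subseteq> space M \<times> space M"
        unfolding F_def using borel_equivD(1,2)[OF S] by blast
      show "refl_on (space M) (F N)" unfolding F_def refl_on_def using borel_equivD(3)[OF S] by simp
      show "sym (F N)" unfolding F_def sym_def using borel_equivD(4)[OF S] by simp
      show "trans (F N)" unfolding F_def trans_def using borel_equivD(5)[OF S] by blast
    qed
    fix x assume "x \<in> space M"
    have "F N `` {x} \<subseteq> (\<lambda>g. \<phi> g x) ` B N" using bS[of N] unfolding F_def bounded_by_def by blast
    then show "finite (F N `` {x})" using R(2) finite_surj by blast
  qed
  moreover have "incseq F"
  proof (rule incseq_SucI)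
    fix N
    have "R (Suc N + n) x y" if "\<forall>n. R (N + n) x y" for n x y
      using that[rule_format, of "Suc n"] by simp
    then show "F N \<subseteq> F (Suc N)" unfolding F_def S_def by auto
  qed
  moreover have "(\<Union>n. F n) = orbit_equivalence G M \<phi>"
  proof (intro Set.set_eqI iffI)
    fix p assume "p \<in> (\<Union>n. F n)"
    then obtain N x y where p: "p = (x, y)" "S N x y" unfolding F_def by auto
    obtain g where g: "g \<in> B N" "y = \<phi> g x" using bS p(2) unfolding bounded_by_def by blast
    then show "p \<in> orbit_equivalence G M \<phi>"
      using R(3)[of N] p borel_equivD(1,2)[OF S p(2)] unfolding orbit_equivalence_def by blast
  next
    fix p assume "p \<in> orbit_equivalence G M \<phi>"
    then obtain x g where p: "p = (x, \<phi> g x)" "x \<in> space M" "g \<in> carrier G"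
      unfolding orbit_equivalence_def by blast
    then obtain N where "\<forall>n\<ge>N. R n x (\<phi> g x)" using ev by blast
    then have "S N x (\<phi> g x)" unfolding S_def by simp
    then show "p \<in> (\<Union>n. F n)" using p(1) unfolding F_def by blast
  qed
  ultimately show ?thesis unfolding hyperfinite_def by blast
qed

end

text \<open>Past m the values never rise, so they are constant once the least one is reached, while
  each n with P n would force a drop.\<close>

lemma eventually_not_decreasing_nat:
  fixes b :: "nat \<Rightarrow> nat"
  assumes "\<And>n. n \<ge> m \<Longrightarrow> b (Suc n) + (if P n then 1 else 0) \<le> b n"
  shows "\<exists>N. \<forall>n\<ge>N. \<not> P n"
proof -
  obtain N where N: "N \<ge> m" "\<And>n. n \<ge> m \<Longrightarrow> b N \<le> b n"
    using ex_has_least_nat[of "\<lambda>n. n \<ge> m" m b] by auto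
  have le: "b n \<le> b N" if "n \<ge> N" for n
    using that
  proof (induction n rule: dec_induct)
    case (step n)
    then show ?case using assms[of n] N(1) by (auto split: if_splits)
  qed simp
  have "\<not> P n" if "n \<ge> N" for n
    using assms[of n] le[OF that] N(2)[of "Suc n"] N(1) that by (auto split: if_splits)
  then show ?thesis by blast
qed

section \<open>Counting the cuts of a pair across the levels\<close>

context borel_action
begin

text \<open>The relation \<open>R (Suc i)\<close> of one level protects the pieces of type \<open>i\<close> of the next level, and
  \<open>R 0\<close> protects nothing. So the number of relations of a level that cut a fixed pair never
  grows with the level, and it drops after each level whose \<open>R 0\<close> cuts the pair.\<close>

lemma hyperfinite_tame_union:
  assumes S: "\<And>n. finite (S n)" "\<And>n. S n \<subseteq> carrier G" "\<And>n. S n \<subseteq> S (Suc n)" "(\<Union>n. S n) = carrier G"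
    and tame: "\<And>n. \<exists>D. tame G (generate G (S n)) D"
  shows "hyperfinite M (orbit_equivalence G M \<phi>)"
proof -
  define H where "H n = generate G (S n)" for n
  have H: "subgroup (H n) G" "S n \<subseteq> H n" "H n \<subseteq> H (Suc n)" for n
    unfolding H_def
    by (rule generate_is_subgroup[OF S(2)], rule subsetI, erule generate.incl, rule mono_generate[OF S(3)])
  obtain D where D: "\<And>n. tame G (H n) (D n)" using tame unfolding H_def by metis
  define good where "good n R \<longleftrightarrow>
      (\<forall>k. borel_equiv (R k) \<and> (\<exists>B. finite B \<and> B \<subseteq> H n \<and> bounded_by B (R k)))"
    for n and R :: "nat \<Rightarrow> 'x \<Rightarrow> 'x \<Rightarrow> bool"
  define step where "step n R R' \<longleftrightarrow> (\<forall>x\<in>space M. \<forall>g\<in>S (Suc n). finite {k. \<not> R' k x (\<phi> g x)} \<and>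
      card {k. \<not> R' k x (\<phi> g x)} \<le> card {i. i < D (Suc n) \<and> \<not> R (Suc i) x (\<phi> g x)})"
    for n and R R' :: "nat \<Rightarrow> 'x \<Rightarrow> 'x \<Rightarrow> bool"
  have "\<exists>R. \<forall>n. good n (R n) \<and> step n (R n) (R (Suc n))"
  proof (rule dependent_nat_choice)
    have "bounded_by {\<one>} (\<lambda>x y. x \<in> space M \<and> x = y)" unfolding bounded_by_def by auto
    \<comment> \<open>Equality serves as every relation of level 0; it may cut a pair infinitely
      often.\<close>
    then have "good 0 (\<lambda>k x y. x \<in> space M \<and> x = y)"
      unfolding good_def using borel_equiv_Id subgroup.one_closed[OF H(1)]
      by (intro allI conjI exI[of _ "{\<one>}"]) auto
    then show "\<exists>R. good 0 R" by blast
  next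
    fix R n assume good: "good n R"
    then have "\<forall>k. \<exists>B. finite B \<and> B \<subseteq> H n \<and> bounded_by B (R k)" unfolding good_def by simp
    then obtain B where B: "\<And>k. finite (B k)" "\<And>k. B k \<subseteq> H n" "\<And>k. bounded_by (B k) (R k)"
      by metis
    \<comment> \<open>Only \<open>D (Suc n)\<close> relations of level n are protected, so a finite
      union bounds them all.\<close>
    define A where "A = (\<Union>i<D (Suc n). B (Suc i))"
    have "\<exists>R' :: nat \<Rightarrow> 'x \<Rightarrow> 'x \<Rightarrow> bool.
      (\<forall>k. borel_equiv (R' k) \<and> (\<exists>B. finite B \<and> B \<subseteq> H (Suc n) \<and> bounded_by B (R' k))) \<and>
      (\<forall>x\<in>space M. \<forall>g\<in>S (Suc n). finite {k. \<not> R' k x (\<phi> g x)} \<and>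
        card {k. \<not> R' k x (\<phi> g x)} \<le> card {i. i < D (Suc n) \<and> \<not> R (Suc i) x (\<phi> g x)})"
    proof (rule orthogonal_sequence[OF H(1) D, where A = A])
      show "borel_equiv (R (Suc i))" for i using good unfolding good_def by simp
      show "bounded_by A (R (Suc i))" if "i < D (Suc n)" for i
        by (rule bounded_by_mono[OF B(3)]) (use that in \<open>auto simp: A_def\<close>)
      show "finite A" "A \<subseteq> H (Suc n)" unfolding A_def using B(1,2) H(3) by blast+
    qed (rule S(1), rule H(2))
    then show "\<exists>R'. good (Suc n) R' \<and> step n R R'" unfolding good_def step_def .
  qed
  then obtain R where R: "\<And>n. good n (R n)" "\<And>n. step n (R n) (R (Suc n))" by blast
  have "\<forall>n. \<exists>B. finite B \<and> B \<subseteq> H n \<and> bounded_by B (R n 0)" using R(1) unfolding good_def by simp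
  then obtain B where B: "\<And>n. finite (B n)" "\<And>n. B n \<subseteq> H n" "\<And>n. bounded_by (B n) (R n 0)"
    by metis
  show ?thesis
  proof (rule hyperfinite_liminf)
    show "borel_equiv (R n 0)" for n using R(1) unfolding good_def by simp
    show "B n \<subseteq> carrier G" for n using B(2) subgroup.subset[OF H(1)] by blast
    fix x g assume x: "x \<in> space M" and g: "g \<in> carrier G"
    obtain m where m: "g \<in> S m" using g S(4) by blast
    have gS: "g \<in> S n" if "n \<ge> m" for n
      using lift_Suc_mono_le[of S, OF S(3) that] m by (rule subsetD)
    define K where "K n = {k. \<not> R n k x (\<phi> g x)}" for n
    have K: "finite (K (Suc n))" "card (K (Suc n)) \<le> card {i. i < D (Suc n) \<and> Suc i \<in> K n}"
      if "n \<ge> m" for n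
      using R(2)[of n, unfolded step_def, rule_format, OF x gS[of "Suc n"]] that
      unfolding K_def by simp_all
    \<comment> \<open>Level m may cut the pair infinitely often; finiteness is known from level
      \<open>Suc m\<close> on.\<close>
    have "card (K (Suc n)) + (if \<not> R n 0 x (\<phi> g x) then 1 else 0) \<le> card (K n)" if n: "n \<ge> Suc m" for n
    proof -
      let ?I = "{i. i < D (Suc n) \<and> Suc i \<in> K n}"
      obtain l where l: "n = Suc l" "l \<ge> m" using n by (cases n) simp_all
      have fin: "finite (K n)" unfolding l(1) by (rule K(1)[OF l(2)])
      \<comment> \<open>The shift by \<open>Suc\<close> leaves index 0 free, so a cut by
        \<open>R n 0\<close> counts in addition to the shifted ones.\<close>
      have "card (K (Suc n)) + (if \<not> R n 0 x (\<phi> g x) then 1 else 0)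
          \<le> card (Suc ` ?I \<union> (if \<not> R n 0 x (\<phi> g x) then {0} else {}))"
      proof -
        have "card (Suc ` ?I \<union> (if \<not> R n 0 x (\<phi> g x) then {0} else {}))
            = card (Suc ` ?I) + (if \<not> R n 0 x (\<phi> g x) then 1 else 0)"
          by (simp add: card_insert_if)
        moreover have "card (Suc ` ?I) = card ?I" by (simp add: card_image)
        ultimately show ?thesis using K(2)[of n] n by simp
      qed
      also have "\<dots> \<le> card (K n)" by (rule card_mono[OF fin]) (auto simp: K_def)
      finally show ?thesis .
    qed
    then have "\<exists>N. \<forall>n\<ge>N. \<not> \<not> R n 0 x (\<phi> g x)"
      by (rule eventually_not_decreasing_nat[where b = "\<lambda>n. card (K n)"])
    then show "\<exists>N. \<forall>n\<ge>N. R n 0 x (\<phi> g x)" by simp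
  qed (rule B)+
qed

end

section \<open>Standard Borel spaces and the conclusion\<close>

text \<open>Small balls about a countable dense set do it: a center close to x gives a ball that
  contains x and is too small to reach F.\<close>

lemma standard_borel_separating:
  assumes "standard_borel_space M"
  shows "\<exists>\<B>. countable \<B> \<and> \<B> \<subseteq> sets M \<and>
    (\<forall>x\<in>space M. \<forall>F. finite F \<longrightarrow> F \<subseteq> space M \<longrightarrow> x \<notin> F \<longrightarrow> (\<exists>B\<in>\<B>. x \<in> B \<and> B \<inter> F = {}))"
proof -
  obtain T where T: "completely_metrizable_space T" "separable_space T" "topspace T = space M"
    "sets M = sigma_sets (topspace T) {U. openin T U}"
    using assms unfolding standard_borel_space_def Polish_topology_def by blast
  obtain U d where d: "Metric_space U d" "T = Metric_space.mtopology U d"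
    using T(1) unfolding completely_metrizable_space_def by blast
  interpret Metric_space U d by (rule d(1))
  have U: "U = space M" using T(3) d(2) by simp
  obtain C where C: "countable C" "C \<subseteq> U" "mtopology closure_of C = U"
    using T(2) unfolding separable_space_def d(2) by auto
  define \<B> where "\<B> = (\<lambda>(c, n). mball c (1 / Suc n)) ` (C \<times> (UNIV :: nat set))"
  show ?thesis
  proof (intro exI[of _ \<B>] conjI ballI allI impI)
    show "countable \<B>" unfolding \<B>_def using C(1) by (intro countable_image countable_SIGMA) auto
    show "\<B> \<subseteq> sets M"
      unfolding \<B>_def T(4) d(2) by (auto intro!: sigma_sets.Basic)
    fix x F assume x: "x \<in> space M" "x \<notin> F" and F: "finite F" "F \<subseteq> space M"
    have xU: "x \<in> U" "\<And>y. y \<in> F \<Longrightarrow> y \<in> U" using x(1) F(2) unfolding U by blast+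
    \<comment> \<open>A lower bound for the distances from x to F; the inserted 1 keeps the minimum
      defined for empty F.\<close>
    define r where "r = Min (insert 1 (d x ` F))"
    have "d x y > 0" if "y \<in> F" for y
      using mdist_pos_less[of x y] xU that x(2) by blast
    then have r: "r > 0" unfolding r_def using F(1) by (subst Min_gr_iff) auto
    have r_le: "r \<le> d x y" if "y \<in> F" for y
      unfolding r_def using F(1) that by (intro Min_le) auto
    obtain n where n: "1 / Suc n < r / 2" using nat_approx_posE[of "r / 2"] r by auto
    have "x \<in> mtopology closure_of C" unfolding C(3) by (rule xU(1))
    then have "\<forall>\<epsilon>>0. \<exists>c\<in>C. c \<in> mball x \<epsilon>" unfolding metric_closure_of by simp
    then obtain c where c: "c \<in> C" "c \<in> mball x (1 / Suc n)"
      by (meson of_nat_0_less_iff zero_less_Suc zero_less_divide_1_iff)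
    have dc: "c \<in> U" "d x c < 1 / Suc n" "d c x < 1 / Suc n"
      using c(2) commute[of x c] unfolding in_mball by simp_all
    have "x \<in> mball c (1 / Suc n)" unfolding in_mball using dc xU(1) by simp
    moreover have "y \<notin> mball c (1 / Suc n)" if y: "y \<in> F" for y
    proof
      assume "y \<in> mball c (1 / Suc n)"
      then have "d c y < 1 / Suc n" unfolding in_mball by simp
      then have "d x y < 1 / Suc n + 1 / Suc n"
        using dc(2) triangle[OF xU(1) dc(1) xU(2)[OF y]] by linarith
      then show False using r_le[OF y] n by linarith
    qed
    ultimately show "\<exists>B\<in>\<B>. x \<in> B \<and> B \<inter> F = {}"
      unfolding \<B>_def using c(1) by (intro bexI[of _ "mball c (1 / Suc n)"]) blast+
  qed
qed

theorem theorem9p3: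
  fixes G :: "('g, 'b) monoid_scheme" and M :: "'x measure" and \<phi> :: "'g \<Rightarrow> 'x \<Rightarrow> 'x"
  assumes "group G"
    and "countable (carrier G)"
    and "locally_nilpotent G"
    and "standard_borel_space M"
    and "group_action G (space M) \<phi>"
    and "\<forall>g \<in> carrier G. \<phi> g \<in> M \<rightarrow>\<^sub>M M"
  shows "hyperfinite M (orbit_equivalence G M \<phi>)"
proof -
  interpret borel_action G M \<phi>
    by (rule borel_action.intro[OF assms(5,2) _ standard_borel_separating[OF assms(4)]])
      (use assms(6) in blast)
  \<comment> \<open>Initial segments of an enumeration of the group; by local nilpotency each
    generates a nilpotent subgroup.\<close>
  define S where "S n = from_nat_into (carrier G) ` {..n}" for n :: nat
  have ne: "carrier G \<noteq> {}" using one_closed by blast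
  have S: "finite (S n)" "S n \<subseteq> carrier G" "S n \<subseteq> S (Suc n)" for n
    unfolding S_def using from_nat_into[OF ne] by auto
  show ?thesis
  proof (rule hyperfinite_tame_union[where S = S])
    show "finite (S n)" "S n \<subseteq> carrier G" "S n \<subseteq> S (Suc n)" for n by (rule S)+
    show "(\<Union>n. S n) = carrier G"
      using range_from_nat_into[OF ne assms(2)] unfolding S_def by blast
    show "\<exists>D. tame G (generate G (S n)) D" for n
      using assms(3) S by (intro nilpotent_tame) (auto simp: locally_nilpotent_def)
  qed
qed

end
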